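(* The parameterized problem Stable Cutset[tc] admits a polynomial kernelization to equivalent instances with $\mathcal{O}(|X|^3)$ vertices. That is, there is an algorithm running in time polynomial in the input size which, given a graph $G$ and a twin cover $X$ of $G$, outputs a graph $G'$ and a twin cover $X'$ of $G'$ such that $G'$ has a stable cutset if and only if $G$ has a stable cutset, and $|V(G')|\le c\cdot |X|^3$ for some absolute constant $c$.
   Context: All graphs are finite and simple. A stable cutset of a graph $G$ is a set $S\subseteq V(G)$ whose vertices are pairwise non-adjacent and such that $G-S$ is disconnected (has at least two connected components); the empty set is a stable cutset of any disconnected graph. For a vertex $v$, $N[v]$ denotes its closed neighborhood. A twin cover of $G$ is a set $X\subseteq V(G)$ such that $N_G[u]=N_G[v]$ holds for every edge $\{u,v\}$ of $G-X$. Stable Cutset[tc]: input is a graph $G$ and a twin cover $X$ of $G$; the parameter is $|X|$; the question is whether $G$ has a stable cutset. A kernelization may alternatively output a constant-size yes- or no-instance. *)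

theory Defs
  imports "Graph_Theory.Graph_Theory" "HOL-Computational_Algebra.Polynomial"
begin

section \<open>Stable cutsets and twin covers\<close>

text \<open>
  Finite simple graphs are the symmetric loop-free digraphs of the locale
  \<^locale>\<open>pair_graph\<close>: every edge is present as a pair of opposite arcs, and the strongly
  connected components are exactly the connected components.
\<close>

definition stable_cutset :: "'a pair_pre_digraph \<Rightarrow> 'a set \<Rightarrow> bool" where
  "stable_cutset G S \<longleftrightarrow>
     S \<subseteq> pverts G \<and>
     (\<forall>u\<in>S. \<forall>v\<in>S. (u, v) \<notin> parcs G) \<and>
     2 \<le> card (pre_digraph.sccs_verts (with_proj G \<restriction> (pverts G - S)))"

definition closed_nbhd :: "'a pair_pre_digraph \<Rightarrow> 'a \<Rightarrow> 'a set" where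
  "closed_nbhd G v = insert v {u. (v, u) \<in> parcs G}"

definition twin_cover :: "'a pair_pre_digraph \<Rightarrow> 'a set \<Rightarrow> bool" where
  "twin_cover G X \<longleftrightarrow>
     X \<subseteq> pverts G \<and>
     (\<forall>(u, v) \<in> parcs G.
        u \<notin> X \<longrightarrow> v \<notin> X \<longrightarrow> closed_nbhd G u = closed_nbhd G v)"


section \<open>Algorithms and their running time\<close>

text \<open>
  The computation model is the WHILE language over binary trees (Jones, \<^emph>\<open>Computability and
  Complexity from a Programming Perspective\<close>). Unlike there, steps do not have unit cost:
  evaluating an expression costs, for each of its subexpressions, one plus the size of the
  value of that subexpression. So values are charged as if they were copied in full, no tree can
  be built in less time than it takes to write it down, and running times agree with those of
  Turing machines up to a polynomial.
\<close>

datatype btree = Leaf | Node (left: btree) (right: btree)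
  where "left Leaf = Leaf" | "right Leaf = Leaf"

text \<open>The overloaded \<^term>\<open>size :: btree \<Rightarrow> nat\<close> is the number of inner nodes.\<close>

type_synonym state = "nat \<Rightarrow> btree"

datatype expr = Var nat | LeafE | NodeE expr expr | LeftE expr | RightE expr

primrec eval_expr :: "expr \<Rightarrow> state \<Rightarrow> btree" where
  "eval_expr (Var x) s = s x"
| "eval_expr LeafE s = Leaf"
| "eval_expr (NodeE a b) s = Node (eval_expr a s) (eval_expr b s)"
| "eval_expr (LeftE a) s = left (eval_expr a s)"
| "eval_expr (RightE a) s = right (eval_expr a s)"

primrec cost_expr :: "expr \<Rightarrow> state \<Rightarrow> nat" where
  "cost_expr (Var x) s = 1 + size (eval_expr (Var x) s)"
| "cost_expr LeafE s = 1 + size (eval_expr LeafE s)"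
| "cost_expr (NodeE a b) s = cost_expr a s + cost_expr b s + 1 + size (eval_expr (NodeE a b) s)"
| "cost_expr (LeftE a) s = cost_expr a s + 1 + size (eval_expr (LeftE a) s)"
| "cost_expr (RightE a) s = cost_expr a s + 1 + size (eval_expr (RightE a) s)"

datatype com =
    Skip
  | Assign nat expr
  | Seq com com
  | Cond expr com com
  | While expr com

text \<open>
  \<open>exec c s t s'\<close>: started in state \<open>s\<close>, the program \<open>c\<close> terminates in state \<open>s'\<close> after time \<open>t\<close>.
  A test succeeds if its value is not \<^const>\<open>Leaf\<close>.
\<close>

inductive exec :: "com \<Rightarrow> state \<Rightarrow> nat \<Rightarrow> state \<Rightarrow> bool" where
  Skip: "exec Skip s 1 s"
| Assign: "exec (Assign x e) s (1 + cost_expr e s) (s(x := eval_expr e s))"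
| Seq: "exec c\<^sub>1 s t\<^sub>1 s\<^sub>1 \<Longrightarrow> exec c\<^sub>2 s\<^sub>1 t\<^sub>2 s\<^sub>2 \<Longrightarrow> exec (Seq c\<^sub>1 c\<^sub>2) s (1 + t\<^sub>1 + t\<^sub>2) s\<^sub>2"
| CondTrue: "eval_expr b s \<noteq> Leaf \<Longrightarrow> exec c\<^sub>1 s t s' \<Longrightarrow>
    exec (Cond b c\<^sub>1 c\<^sub>2) s (1 + cost_expr b s + t) s'"
| CondFalse: "eval_expr b s = Leaf \<Longrightarrow> exec c\<^sub>2 s t s' \<Longrightarrow>
    exec (Cond b c\<^sub>1 c\<^sub>2) s (1 + cost_expr b s + t) s'"
| WhileFalse: "eval_expr b s = Leaf \<Longrightarrow> exec (While b c) s (1 + cost_expr b s) s"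
| WhileTrue: "eval_expr b s \<noteq> Leaf \<Longrightarrow> exec c s t\<^sub>1 s\<^sub>1 \<Longrightarrow> exec (While b c) s\<^sub>1 t\<^sub>2 s\<^sub>2 \<Longrightarrow>
    exec (While b c) s (1 + cost_expr b s + t\<^sub>1 + t\<^sub>2) s\<^sub>2"

inductive_cases exec_SkipE: "exec Skip s t s'"
inductive_cases exec_AssignE: "exec (Assign x e) s t s'"
inductive_cases exec_SeqE: "exec (Seq c\<^sub>1 c\<^sub>2) s t s'"
inductive_cases exec_CondE: "exec (Cond b c\<^sub>1 c\<^sub>2) s t s'"
inductive_cases exec_WhileE: "exec (While b c) s t s'"

lemma exec_deterministic:
  "exec c s t s' \<Longrightarrow> exec c s u s'' \<Longrightarrow> t = u \<and> s' = s''"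
proof (induction arbitrary: u s'' rule: exec.induct)
  case (Skip s)
  then show ?case by (rule exec_SkipE) simp
next
  case (Assign x e s)
  then show ?case by (rule exec_AssignE) simp
next
  case (Seq c\<^sub>1 s t\<^sub>1 s\<^sub>1 c\<^sub>2 t\<^sub>2 s\<^sub>2)
  from Seq.prems obtain u\<^sub>1 r u\<^sub>2
    where r: "exec c\<^sub>1 s u\<^sub>1 r" "exec c\<^sub>2 r u\<^sub>2 s''" and u: "u = 1 + u\<^sub>1 + u\<^sub>2"
    by (elim exec_SeqE) auto
  from Seq.IH(1)[OF r(1)] have "t\<^sub>1 = u\<^sub>1" "s\<^sub>1 = r" by simp_all
  moreover have "t\<^sub>2 = u\<^sub>2 \<and> s\<^sub>2 = s''"
    by (rule Seq.IH(2)) (use calculation r(2) in simp)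
  ultimately show ?case using u by simp
next
  case (CondTrue b s c\<^sub>1 t s' c\<^sub>2)
  from CondTrue.prems CondTrue.hyps(1) obtain u'
    where "exec c\<^sub>1 s u' s''" and u: "u = 1 + cost_expr b s + u'"
    by (elim exec_CondE) auto
  from CondTrue.IH[OF this(1)] u show ?case by simp
next
  case (CondFalse b s c\<^sub>2 t s' c\<^sub>1)
  from CondFalse.prems CondFalse.hyps(1) obtain u'
    where "exec c\<^sub>2 s u' s''" and u: "u = 1 + cost_expr b s + u'"
    by (elim exec_CondE) auto
  from CondFalse.IH[OF this(1)] u show ?case by simp
next
  case (WhileFalse b s c)
  show ?case
    by (rule exec_WhileE[OF WhileFalse.prems]) (use WhileFalse.hyps in auto)
next
  case (WhileTrue b s c t\<^sub>1 s\<^sub>1 t\<^sub>2 s\<^sub>2)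
  obtain u\<^sub>1 r u\<^sub>2
    where r: "exec c s u\<^sub>1 r" "exec (While b c) r u\<^sub>2 s''"
      and u: "u = 1 + cost_expr b s + u\<^sub>1 + u\<^sub>2"
    by (rule exec_WhileE[OF WhileTrue.prems]) (use WhileTrue.hyps(1) in auto)
  from WhileTrue.IH(1)[OF r(1)] have "t\<^sub>1 = u\<^sub>1" "s\<^sub>1 = r" by simp_all
  moreover have "t\<^sub>2 = u\<^sub>2 \<and> s\<^sub>2 = s''"
    by (rule WhileTrue.IH(2)) (use calculation r(2) in simp)
  ultimately show ?case using u by simp
qed

definition input_state :: "btree \<Rightarrow> state" where
  "input_state d = (\<lambda>_. Leaf)(0 := d)"

definition computes_in_time :: "com \<Rightarrow> btree \<Rightarrow> nat \<Rightarrow> btree \<Rightarrow> bool" where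
  "computes_in_time c d t r \<longleftrightarrow> (\<exists>s'. exec c (input_state d) t s' \<and> s' 0 = r)"


section \<open>Encoding of instances\<close>

primrec encode_bool :: "bool \<Rightarrow> btree" where
  "encode_bool False = Leaf"
| "encode_bool True = Node Leaf Leaf"

primrec encode_list :: "btree list \<Rightarrow> btree" where
  "encode_list [] = Leaf"
| "encode_list (x # xs) = Node x (encode_list xs)"

text \<open>
  An instance consists of a graph with vertices \<open>0, \<dots>, n - 1\<close> and a twin cover of it; it is
  presented by the characteristic vector of the twin cover and the adjacency matrix.
\<close>

definition tc_instance :: "nat pair_pre_digraph \<Rightarrow> nat set \<Rightarrow> bool" where
  "tc_instance G X \<longleftrightarrow> pair_graph G \<and> (\<exists>n. pverts G = {..<n}) \<and> twin_cover G X"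

definition encode :: "nat pair_pre_digraph \<Rightarrow> nat set \<Rightarrow> btree" where
  "encode G X =
    (let vs = [0..<card (pverts G)] in
     Node (encode_list (map (\<lambda>v. encode_bool (v \<in> X)) vs))
          (encode_list (map (\<lambda>u. encode_list (map (\<lambda>v. encode_bool ((u, v) \<in> parcs G)) vs)) vs)))"

lemma encode_bool_inject [simp]: "encode_bool a = encode_bool b \<longleftrightarrow> a = b"
  by (cases a; cases b) auto

lemma encode_list_inject [simp]: "encode_list xs = encode_list ys \<longleftrightarrow> xs = ys"
proof (induction xs arbitrary: ys)
  case Nil
  show ?case by (cases ys) auto
next
  case (Cons x xs)
  then show ?case by (cases ys) auto
qed

lemma encode_inject:
  assumes "tc_instance G X" "tc_instance G' X'" "encode G X = encode G' X'"
  shows "G = G' \<and> X = X'"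
proof -
  from assms obtain n n' where n: "pverts G = {..<n}" "pverts G' = {..<n'}"
    by (auto simp: tc_instance_def)
  interpret G: pair_graph G using assms(1) by (simp add: tc_instance_def)
  interpret G': pair_graph G' using assms(2) by (simp add: tc_instance_def)
  have wf: "X \<subseteq> {..<n}" "X' \<subseteq> {..<n'}"
    using assms(1,2) n by (simp_all add: tc_instance_def twin_cover_def)
  have wf_G: "u < n \<and> v < n" if "(u, v) \<in> parcs G" for u v
    using G.in_arcsD1[OF that] G.in_arcsD2[OF that] n by simp
  have wf_G': "u < n' \<and> v < n'" if "(u, v) \<in> parcs G'" for u v
    using G'.in_arcsD1[OF that] G'.in_arcsD2[OF that] n by simp
  have eqs:
    "map (\<lambda>v. encode_bool (v \<in> X)) [0..<n] = map (\<lambda>v. encode_bool (v \<in> X')) [0..<n']"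
    "map (\<lambda>u. encode_list (map (\<lambda>v. encode_bool ((u, v) \<in> parcs G)) [0..<n])) [0..<n] =
     map (\<lambda>u. encode_list (map (\<lambda>v. encode_bool ((u, v) \<in> parcs G')) [0..<n'])) [0..<n']"
    using assms(3) n by (simp_all add: encode_def Let_def)
  have "length [0..<n] = length [0..<n']"
    using map_eq_imp_length_eq[OF eqs(1)] .
  then have nn: "n' = n"
    by simp
  have "\<forall>v<n. v \<in> X \<longleftrightarrow> v \<in> X'"
    using eqs(1) unfolding nn by simp
  then have X: "X = X'"
    using wf unfolding nn by auto
  have "\<forall>u<n. \<forall>v<n. (u, v) \<in> parcs G \<longleftrightarrow> (u, v) \<in> parcs G'"
    using eqs(2) unfolding nn by simp
  then have "(u, v) \<in> parcs G \<longleftrightarrow> (u, v) \<in> parcs G'" for u v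
    using wf_G[of u v] wf_G'[of u v] unfolding nn by blast
  then have "parcs G = parcs G'"
    by (intro set_eqI) (simp only: split_paired_all)
  then show ?thesis using n nn X by (intro conjI pair_pre_digraph.equality) simp_all
qed

end

theory Submission
  imports Defs
begin

text \<open>
  Outside the twin cover \<open>X\<close> the graph is a disjoint union of cliques of twins. If some outside
  vertex \<open>v\<close> has a stable neighbourhood in \<open>X\<close> and does not see every vertex, that neighbourhood
  separates the clique of \<open>v\<close> from the rest and the answer is yes. Otherwise both sides of any
  separation meet \<open>X\<close>, and a partition of \<open>X\<close> into two sides \<open>A\<close>, \<open>B\<close> and a stable set \<open>S\<close>
  extends to the whole graph iff no outside vertex with a twin sees both \<open>A\<close> and \<open>B\<close>, and no outside
  vertex sees all of \<open>A\<close>, \<open>B\<close>, \<open>S\<close>. A violation is witnessed by a pair or a triple of vertices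
  of \<open>X\<close>, so it suffices to keep, besides \<open>X\<close>, the first outside vertex adjacent to each triple
  and the first twin pair adjacent to each pair.

  The vertices to keep are defined by a first-order formula over the ordered graph, and
  polynomial time is closed under bounded quantification over a list.
\<close>

section \<open>Polynomial-time functions on binary trees\<close>

lemma poly_nat_mono: "x \<le> y \<Longrightarrow> poly p x \<le> poly p y" for p :: "nat poly"
  by (induction p) (auto intro!: mult_mono)

text \<open>Exact times depend on the data; upper bounds can be added up along a program.\<close>

definition exec_within :: "com \<Rightarrow> state \<Rightarrow> nat \<Rightarrow> state \<Rightarrow> bool" where
  "exec_within c s T s' \<longleftrightarrow> (\<exists>t\<le>T. exec c s t s')"

lemma exec_within_Assign:
  "1 + cost_expr e s \<le> T \<Longrightarrow> exec_within (Assign x e) s T (s(x := eval_expr e s))"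
  unfolding exec_within_def using exec.Assign by blast

lemma exec_within_Seq:
  assumes "exec_within c s T s'" "exec_within c' s' T' s''" "1 + T + T' \<le> U"
  shows "exec_within (Seq c c') s U s''"
proof -
  obtain t t' where "t \<le> T" "exec c s t s'" "t' \<le> T'" "exec c' s' t' s''"
    using assms(1,2) unfolding exec_within_def by blast
  then show ?thesis
    unfolding exec_within_def using assms(3) by (intro exI[of _ "1 + t + t'"]) (auto intro: exec.Seq simp del: One_nat_def)
qed

lemma exec_within_Cond:
  assumes "exec_within (if eval_expr b s \<noteq> Leaf then c else c') s T s'" "1 + cost_expr b s + T \<le> U"
  shows "exec_within (Cond b c c') s U s'"
proof -
  obtain t where t: "t \<le> T" "exec (if eval_expr b s \<noteq> Leaf then c else c') s t s'"
    using assms(1) unfolding exec_within_def by blast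
  then have "exec (Cond b c c') s (1 + cost_expr b s + t) s'"
    by (cases "eval_expr b s = Leaf") (auto intro: exec.CondTrue exec.CondFalse simp del: One_nat_def)
  then show ?thesis
    unfolding exec_within_def using t(1) assms(2) by (intro exI[of _ "1 + cost_expr b s + t"]) auto
qed

lemma exec_within_WhileFalse:
  "eval_expr b s = Leaf \<Longrightarrow> 1 + cost_expr b s \<le> T \<Longrightarrow> exec_within (While b c) s T s"
  unfolding exec_within_def using exec.WhileFalse by blast

lemma exec_within_WhileTrue:
  assumes "eval_expr b s \<noteq> Leaf" "exec_within c s T s'" "exec_within (While b c) s' T' s''"
    "1 + cost_expr b s + T + T' \<le> U"
  shows "exec_within (While b c) s U s''"
proof -
  obtain t t' where "t \<le> T" "exec c s t s'" "t' \<le> T'" "exec (While b c) s' t' s''"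
    using assms(2,3) unfolding exec_within_def by blast
  then show ?thesis
    unfolding exec_within_def using assms(1,4)
    by (intro exI[of _ "1 + cost_expr b s + t + t'"]) (auto intro: exec.WhileTrue simp del: One_nat_def)
qed

lemma size_eval_expr_le: "size (eval_expr e s) \<le> cost_expr e s"
  by (cases e) auto

text \<open>An assignment is charged at least the size of the value it stores, so growth is paid for
  by elapsed time.\<close>

lemma size_exec_le: "exec c s t s' \<Longrightarrow> size (s' x) \<le> size (s x) + t"
  by (induction rule: exec.induct) (auto intro: le_trans[OF size_eval_expr_le])

text \<open>
  The variables from \<open>m\<close> on are untouched and the others may hold garbage initially, so programs
  can be chained and used as loop bodies, with fresh variables for saved values.
\<close>

definition runs :: "com \<Rightarrow> nat \<Rightarrow> nat poly \<Rightarrow> (btree \<Rightarrow> btree) \<Rightarrow> bool" where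
  "runs c m p f \<longleftrightarrow> (\<forall>s. \<exists>s'. exec_within c s (poly p (size (s 0))) s' \<and>
     s' 0 = f (s 0) \<and> (\<forall>x\<ge>m. s' x = s x))"

definition ptime :: "(btree \<Rightarrow> btree) \<Rightarrow> bool" where
  "ptime f \<longleftrightarrow> (\<exists>c m p. runs c m p f)"

lemma runsE:
  assumes "runs c m p f"
  obtains s' where "exec_within c s (poly p (size (s 0))) s'" "s' 0 = f (s 0)" "\<And>x. m \<le> x \<Longrightarrow> s' x = s x"
  using assms unfolding runs_def by meson

text \<open>Polynomial time forces polynomial output, which keeps the running times of composed
  programs polynomial.\<close>

lemma runs_size_le:
  assumes "runs c m p f"
  shows "size (f d) \<le> size d + poly p (size d)"
proof -
  obtain s' where s': "exec_within c (\<lambda>_. d) (poly p (size d)) s'" "s' 0 = f d"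
    using assms by (rule runsE[where s = "\<lambda>_. d"]) blast
  then show ?thesis
    unfolding exec_within_def using size_exec_le[of c "\<lambda>_. d" _ s' 0] by fastforce
qed

lemma ptime_size_bound:
  assumes "ptime f"
  obtains q :: "nat poly" where "\<And>d. size (f d) \<le> poly q (size d)"
proof -
  obtain c m p where r: "runs c m p f"
    using assms unfolding ptime_def by blast
  show thesis
    by (rule that[of "[:0, 1:] + p"]) (use runs_size_le[OF r] in simp)
qed

section \<open>Composition, constructors and conditionals\<close>

lemma ptime_id: "ptime (\<lambda>d. d)"
proof -
  have "runs Skip 0 1 (\<lambda>d. d)"
    unfolding runs_def exec_within_def using exec.Skip by fastforce
  then show ?thesis unfolding ptime_def by blast
qed

lemma ptime_comp:
  assumes "ptime f" "ptime g"
  shows "ptime (\<lambda>d. f (g d))"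
proof -
  obtain cf mf pf cg mg pg where f: "runs cf mf pf f" and g: "runs cg mg pg g"
    using assms unfolding ptime_def by blast
  \<comment> \<open>\<open>pf\<close> is evaluated at \<open>size d + pg (size d)\<close>, which
    bounds the size of the intermediate result; the summand 1 pays for \<open>Seq\<close>.\<close>
  define p where "p = 1 + pg + pcompose pf ([:0, 1:] + pg)"
  have "runs (Seq cg cf) (max mf mg) p (\<lambda>d. f (g d))"
    unfolding runs_def
  proof
    fix s :: state
    obtain s1 where s1: "exec_within cg s (poly pg (size (s 0))) s1" "s1 0 = g (s 0)"
      "\<And>x. mg \<le> x \<Longrightarrow> s1 x = s x"
      using runsE[OF g, where s = s] by blast
    obtain s2 where s2: "exec_within cf s1 (poly pf (size (s1 0))) s2" "s2 0 = f (s1 0)"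
      "\<And>x. mf \<le> x \<Longrightarrow> s2 x = s1 x"
      using runsE[OF f, where s = s1] by blast
    have "poly pf (size (s1 0)) \<le> poly pf (size (s 0) + poly pg (size (s 0)))"
      using runs_size_le[OF g, of "s 0"] s1(2) by (intro poly_nat_mono) simp
    then have "exec_within (Seq cg cf) s (poly p (size (s 0))) s2"
      by (intro exec_within_Seq[OF s1(1) s2(1)]) (simp add: p_def poly_pcompose)
    then show "\<exists>s'. exec_within (Seq cg cf) s (poly p (size (s 0))) s' \<and>
        s' 0 = f (g (s 0)) \<and> (\<forall>x\<ge>max mf mg. s' x = s x)"
      using s1 s2 by auto
  qed
  then show ?thesis unfolding ptime_def by blast
qed

text \<open>The first premise says that the value depends on variable 0 only, hence is a function of
  the input tree.\<close>

lemma ptime_expr: "ptime (\<lambda>d. eval_expr e (\<lambda>_. d))" if "\<And>s. eval_expr e s = eval_expr e (\<lambda>_. s 0)"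
    and "\<And>s. cost_expr e s \<le> poly p (size (s 0))"
proof -
  have "exec_within (Assign 0 e) s (poly (1 + p) (size (s 0))) (s(0 := eval_expr e s))" for s
    by (rule exec_within_Assign) (use that(2)[of s] in simp)
  then have "runs (Assign 0 e) 1 (1 + p) (\<lambda>d. eval_expr e (\<lambda>_. d))"
    unfolding runs_def using that(1) by fastforce
  then show ?thesis unfolding ptime_def by blast
qed

lemma ptime_left: "ptime f \<Longrightarrow> ptime (\<lambda>d. left (f d))"
proof (rule ptime_comp[of left])
  have "size (left d) \<le> size d" for d by (cases d) auto
  then show "ptime left"
    using ptime_expr[of "LeftE (Var 0)" "[:2, 2:]"] by (simp add: mult_2_right)
qed

lemma ptime_right: "ptime f \<Longrightarrow> ptime (\<lambda>d. right (f d))"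
proof (rule ptime_comp[of right])
  have "size (right d) \<le> size d" for d by (cases d) auto
  then show "ptime right"
    using ptime_expr[of "RightE (Var 0)" "[:2, 2:]"] by (simp add: mult_2_right)
qed

lemma ptime_Leaf: "ptime (\<lambda>_. Leaf)"
  using ptime_expr[of LeafE 1] by simp

lemma ptime_Node:
  assumes "ptime f" "ptime g"
  shows "ptime (\<lambda>d. Node (f d) (g d))"
proof -
  obtain cf mf pf cg mg pg where f: "runs cf mf pf f" and g: "runs cg mg pg g"
    using assms unfolding ptime_def by blast
  \<comment> \<open>From \<open>m\<close> on neither program touches anything, so \<open>m\<close>
    can keep the input and \<open>m + 1\<close> the first result; \<open>1 \<le> m\<close> separates
    both from variable 0.\<close>
  define m where "m = max 1 (max mf mg)"
  have m: "1 \<le> m" "mf \<le> m" "mg \<le> m" by (auto simp: m_def)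
  define c where "c = Seq (Assign m (Var 0)) (Seq cf (Seq (Assign (Suc m) (Var 0))
    (Seq (Assign 0 (Var m)) (Seq cg (Assign 0 (NodeE (Var (Suc m)) (Var 0)))))))"
  \<comment> \<open>The coefficients are generous: the assignments copy the input and the two
    results, whose sizes \<open>runs_size_le\<close> bounds.\<close>
  define p where "p = [:50, 10:] + smult 10 pf + smult 10 pg"
  have "runs c (m + 2) p (\<lambda>d. Node (f d) (g d))"
    unfolding runs_def
  proof
    fix s :: state
    let ?d = "s 0"
    let ?s1 = "s(m := ?d)"
    obtain s2 where s2: "exec_within cf ?s1 (poly pf (size (?s1 0))) s2" "s2 0 = f (?s1 0)"
      "\<And>x. mf \<le> x \<Longrightarrow> s2 x = ?s1 x"
      using runsE[OF f, where s = "?s1"] by blast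
    let ?s3 = "s2(Suc m := f ?d)"
    let ?s4 = "?s3(0 := ?d)"
    obtain s5 where s5: "exec_within cg ?s4 (poly pg (size (?s4 0))) s5" "s5 0 = g (?s4 0)"
      "\<And>x. mg \<le> x \<Longrightarrow> s5 x = ?s4 x"
      using runsE[OF g, where s = "?s4"] by blast
    let ?s6 = "s5(0 := Node (f ?d) (g ?d))"
    note sizes = runs_size_le[OF f, of ?d] runs_size_le[OF g, of ?d]
    have v: "s2 0 = f ?d" "s2 m = ?d" "s5 0 = g ?d" "s5 (Suc m) = f ?d"
      using s2 s5 m by auto
    have 1: "exec_within (Assign m (Var 0)) s (2 + size ?d) ?s1"
      using exec_within_Assign[of "Var 0" s] by simp
    have 2: "exec_within cf ?s1 (poly pf (size ?d)) s2"
      using s2(1) m by simp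
    have 3: "exec_within (Assign (Suc m) (Var 0)) s2 (2 + size (f ?d)) ?s3"
      using exec_within_Assign[of "Var 0" s2 _ "Suc m"] v by simp
    have 4: "exec_within (Assign 0 (Var m)) ?s3 (2 + size ?d) ?s4"
      using exec_within_Assign[of "Var m" ?s3 _ 0] v by simp
    have 5: "exec_within cg ?s4 (poly pg (size ?d)) s5"
      using s5(1) by simp
    have 6: "exec_within (Assign 0 (NodeE (Var (Suc m)) (Var 0))) s5
        (5 + 2 * size (f ?d) + 2 * size (g ?d)) ?s6"
      using exec_within_Assign[of "NodeE (Var (Suc m)) (Var 0)" s5 _ 0] v by simp
    have "exec_within c s (poly p (size ?d)) ?s6"
      unfolding c_def
      by (rule exec_within_Seq[OF 1 exec_within_Seq[OF 2 exec_within_Seq[OF 3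
          exec_within_Seq[OF 4 exec_within_Seq[OF 5 6 order_refl] order_refl] order_refl] order_refl]])
        (use sizes in \<open>simp add: p_def\<close>)
    then show "\<exists>s'. exec_within c s (poly p (size (s 0))) s' \<and>
        s' 0 = Node (f (s 0)) (g (s 0)) \<and> (\<forall>x\<ge>m + 2. s' x = s x)"
      using s2(3) s5(3) m by (intro exI[of _ ?s6]) auto
  qed
  then show ?thesis unfolding ptime_def by blast
qed

lemma ptime_const: "ptime (\<lambda>_. t)"
  by (induction t) (auto intro: ptime_Leaf ptime_Node)

lemmas ptime_basic = ptime_Node ptime_left ptime_right ptime_id ptime_const

text \<open>As for \<open>Node\<close>, the input is saved and restored around the test; only one
  branch runs, and \<open>pf + pg\<close> bounds either.\<close>

lemma ptime_if_Leaf: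
  assumes "ptime b" "ptime f" "ptime g"
  shows "ptime (\<lambda>d. if b d \<noteq> Leaf then f d else g d)"
proof -
  obtain cb mb pb cf mf pf cg mg pg
    where b: "runs cb mb pb b" and f: "runs cf mf pf f" and g: "runs cg mg pg g"
    using assms unfolding ptime_def by blast
  define m where "m = max 1 (max mb (max mf mg))"
  have m: "1 \<le> m" "mb \<le> m" "mf \<le> m" "mg \<le> m" by (auto simp: m_def)
  define c where "c = Seq (Assign m (Var 0)) (Seq cb (Seq (Assign (Suc m) (Var 0))
    (Seq (Assign 0 (Var m)) (Cond (Var (Suc m)) cf cg))))"
  define p where "p = [:50, 10:] + smult 10 pb + pf + pg"
  have "runs c (m + 2) p (\<lambda>d. if b d \<noteq> Leaf then f d else g d)"
    unfolding runs_def
  proof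
    fix s :: state
    let ?d = "s 0"
    let ?s1 = "s(m := ?d)"
    obtain s2 where s2: "exec_within cb ?s1 (poly pb (size (?s1 0))) s2" "s2 0 = b (?s1 0)"
      "\<And>x. mb \<le> x \<Longrightarrow> s2 x = ?s1 x"
      using runsE[OF b, where s = "?s1"] by blast
    let ?s3 = "s2(Suc m := b ?d)"
    let ?s4 = "?s3(0 := ?d)"
    obtain s5 where s5: "exec_within (if b ?d \<noteq> Leaf then cf else cg) ?s4 (poly (pf + pg) (size ?d)) s5"
      "s5 0 = (if b ?d \<noteq> Leaf then f ?d else g ?d)" "\<And>x. m \<le> x \<Longrightarrow> s5 x = ?s4 x"
    proof (cases "b ?d = Leaf")
      case True
      obtain s5 where "exec_within cg ?s4 (poly pg (size (?s4 0))) s5" "s5 0 = g (?s4 0)"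
        "\<And>x. mg \<le> x \<Longrightarrow> s5 x = ?s4 x"
        using runsE[OF g, where s = "?s4"] by blast
      then show ?thesis
        using True m by (intro that[of s5]) (auto simp: exec_within_def intro: trans_le_add2)
    next
      case False
      obtain s5 where "exec_within cf ?s4 (poly pf (size (?s4 0))) s5" "s5 0 = f (?s4 0)"
        "\<And>x. mf \<le> x \<Longrightarrow> s5 x = ?s4 x"
        using runsE[OF f, where s = "?s4"] by blast
      then show ?thesis
        using False m by (intro that[of s5]) (auto simp: exec_within_def intro: trans_le_add1)
    qed
    have v: "s2 0 = b ?d" "s2 m = ?d"
      using s2 m by auto
    have 1: "exec_within (Assign m (Var 0)) s (2 + size ?d) ?s1"
      using exec_within_Assign[of "Var 0" s] by simp
    have 2: "exec_within cb ?s1 (poly pb (size ?d)) s2"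
      using s2(1) m by simp
    have 3: "exec_within (Assign (Suc m) (Var 0)) s2 (2 + size (b ?d)) ?s3"
      using exec_within_Assign[of "Var 0" s2 _ "Suc m"] v by simp
    have 4: "exec_within (Assign 0 (Var m)) ?s3 (2 + size ?d) ?s4"
      using exec_within_Assign[of "Var m" ?s3 _ 0] v by simp
    have 5: "exec_within (Cond (Var (Suc m)) cf cg) ?s4
        (2 + size (b ?d) + poly (pf + pg) (size ?d)) s5"
      by (rule exec_within_Cond[where T = "poly (pf + pg) (size ?d)"]) (use s5(1) in \<open>simp_all\<close>)
    have "exec_within c s (poly p (size ?d)) s5"
      unfolding c_def
      by (rule exec_within_Seq[OF 1 exec_within_Seq[OF 2 exec_within_Seq[OF 3
          exec_within_Seq[OF 4 5 order_refl] order_refl] order_refl]])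
        (use runs_size_le[OF b, of ?d] in \<open>simp add: p_def\<close>)
    then show "\<exists>s'. exec_within c s (poly p (size (s 0))) s' \<and>
        s' 0 = (if b (s 0) \<noteq> Leaf then f (s 0) else g (s 0)) \<and> (\<forall>x\<ge>m + 2. s' x = s x)"
      using s2(3) s5(2,3) m by (intro exI[of _ s5]) auto
  qed
  then show ?thesis unfolding ptime_def by blast
qed

section \<open>Folding over encoded lists\<close>

primrec decode_list :: "btree \<Rightarrow> btree list" where
  "decode_list Leaf = []"
| "decode_list (Node x xs) = x # decode_list xs"

lemma decode_encode_list [simp]: "decode_list (encode_list xs) = xs"
  by (induction xs) auto

lemma encode_decode_list [simp]: "encode_list (decode_list t) = t"
  by (induction t) auto

lemma size_encode_list: "size (encode_list xs) = length xs + sum_list (map size xs)"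
  by (induction xs) auto

lemma length_decode_list_le: "length (decode_list t) \<le> size t"
  by (induction t) auto

lemma size_le_size_encode_list: "x \<in> set xs \<Longrightarrow> size x \<le> size (encode_list xs)"
  by (induction xs) auto

text \<open>Iterating a polynomial-time step may blow up the accumulator, so \<open>bound\<close>
  controls its size after every prefix of the list. The step receives its three arguments packed as
  \<open>Node d (Node x a)\<close>.\<close>

lemma ptime_fold:
  assumes l: "ptime (\<lambda>d. encode_list (l d))" and i: "ptime i"
    and f: "ptime (\<lambda>e. f (left e) (left (right e)) (right (right e)))"
    and bound: "\<And>d ys zs. l d = ys @ zs \<Longrightarrow> size (fold (f d) ys (i d)) \<le> poly q (size d)"
  shows "ptime (\<lambda>d. fold (f d) (l d) (i d))"
proof -
  let ?F = "\<lambda>e. f (left e) (left (right e)) (right (right e))"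
  obtain cl ml pl ci mi pi cf mf pf
    where rl: "runs cl ml pl (\<lambda>d. encode_list (l d))" and ri: "runs ci mi pi i" and rf: "runs cf mf pf ?F"
    using assms unfolding ptime_def by blast
  \<comment> \<open>Register \<open>m\<close> will hold the input, \<open>m + 1\<close> the unread
    rest of the list, \<open>m + 2\<close> the accumulator.\<close>
  define m where "m = max 1 (max ml (max mi mf))"
  have m: "1 \<le> m" "ml \<le> m" "mi \<le> m" "mf \<le> m" by (auto simp: m_def)
  define lp where "lp = [:0, 1:] + pl"
  define body where "body = Seq (Assign 0 (NodeE (Var m) (NodeE (LeftE (Var (m + 1))) (Var (m + 2)))))
    (Seq cf (Seq (Assign (m + 2) (Var 0)) (Assign (m + 1) (RightE (Var (m + 1))))))"
  \<comment> \<open>The cost of one round; the argument of \<open>pf\<close> bounds the size of the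
    packed tree \<open>Node d (Node z a)\<close>.\<close>
  define step where "step = [:50, 10:] + smult 10 lp + smult 10 q + pcompose pf ([:2, 1:] + lp + q)"
  define c where "c = Seq (Assign m (Var 0)) (Seq cl (Seq (Assign (m + 1) (Var 0))
    (Seq (Assign 0 (Var m)) (Seq ci (Seq (Assign (m + 2) (Var 0))
    (Seq (While (Var (m + 1)) body) (Assign 0 (Var (m + 2)))))))))"
  define p where "p = [:50, 10:] + pi + smult 10 lp + smult 10 q + (lp + 1) * step"
  have size_l: "size (encode_list (l d)) \<le> poly lp (size d)" for d
    using runs_size_le[OF rl, of d] by (simp add: lp_def)

  \<comment> \<open>Loop invariant: \<open>ys\<close> has been consumed and \<open>zs\<close> is
    left. The summand 1 in \<open>length zs + 1\<close> accounts for the final failing test.\<close>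
  have loop: "\<exists>s'. exec_within (While (Var (m + 1)) body) s ((length zs + 1) * poly step (size d)) s' \<and>
      s' (m + 2) = fold (f d) (l d) (i d) \<and> (\<forall>x\<ge>m + 3. s' x = s x)"
    if "l d = ys @ zs" "s m = d" "s (m + 1) = encode_list zs" "s (m + 2) = fold (f d) ys (i d)"
    for d ys zs s
    using that
  proof (induction zs arbitrary: ys s)
    case Nil
    have "exec_within (While (Var (m + 1)) body) s (poly step (size d)) s"
      by (rule exec_within_WhileFalse) (use Nil in \<open>simp_all add: step_def\<close>)
    then show ?case using Nil by auto
  next
    case (Cons z zs)
    let ?a = "fold (f d) ys (i d)"
    let ?e = "Node d (Node z ?a)"
    let ?L = "poly lp (size d)" and ?Q = "poly q (size d)"
    have sz: "size (encode_list (z # zs)) \<le> ?L"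
      using size_l[of d] Cons.prems(1) by (simp add: size_encode_list)
    have sa: "size ?a \<le> ?Q"
      using bound[OF Cons.prems(1)] .
    have sfa: "size (f d z ?a) \<le> ?Q"
      using bound[of d "ys @ [z]" zs] Cons.prems(1) by simp
    let ?s1 = "s(0 := ?e)"
    obtain s2 where s2: "exec_within cf ?s1 (poly pf (size (?s1 0))) s2" "s2 0 = ?F (?s1 0)"
      "\<And>x. mf \<le> x \<Longrightarrow> s2 x = ?s1 x"
      using runsE[OF rf, where s = "?s1"] by blast
    let ?s3 = "s2(m + 2 := f d z ?a)"
    let ?s4 = "?s3(m + 1 := encode_list zs)"
    have v: "s2 0 = f d z ?a" "s2 (m + 1) = encode_list (z # zs)" "s2 m = d"
      using s2(2,3) m Cons.prems by auto
    have 1: "exec_within (Assign 0 (NodeE (Var m) (NodeE (LeftE (Var (m + 1))) (Var (m + 2))))) s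
        (20 + 5 * size d + 5 * ?L + 5 * ?Q) ?s1"
    proof -
      have "1 + cost_expr (NodeE (Var m) (NodeE (LeftE (Var (m + 1))) (Var (m + 2)))) s
          \<le> 20 + 5 * size d + 5 * ?L + 5 * ?Q"
        using Cons.prems sz sa by simp
      from exec_within_Assign[OF this, of 0] show ?thesis
        using Cons.prems by simp
    qed
    have "poly pf (size ?e) \<le> poly pf (2 + size d + ?L + ?Q)"
      by (rule poly_nat_mono) (use sz sa in simp)
    with s2(1) have 2: "exec_within cf ?s1 (poly pf (2 + size d + ?L + ?Q)) s2"
      unfolding exec_within_def using order_trans by fastforce
    have 3: "exec_within (Assign (m + 2) (Var 0)) s2 (2 + ?Q) ?s3"
      using exec_within_Assign[of "Var 0" s2 _ "m + 2"] v sfa by simp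
    have 4: "exec_within (Assign (m + 1) (RightE (Var (m + 1)))) ?s3 (5 + 2 * ?L) ?s4"
      using exec_within_Assign[of "RightE (Var (m + 1))" ?s3 "5 + 2 * ?L" "m + 1"] v sz by simp
    have body: "exec_within body s
        (30 + 5 * size d + 7 * ?L + 6 * ?Q + poly pf (2 + size d + ?L + ?Q)) ?s4"
      unfolding body_def
      by (rule exec_within_Seq[OF 1 exec_within_Seq[OF 2 exec_within_Seq[OF 3 4 order_refl] order_refl]]) simp
    have "\<exists>s'. exec_within (While (Var (m + 1)) body) ?s4 ((length zs + 1) * poly step (size d)) s' \<and>
      s' (m + 2) = fold (f d) (l d) (i d) \<and> (\<forall>x\<ge>m + 3. s' x = ?s4 x)"
      using Cons.prems v by (intro Cons.IH[of "ys @ [z]"]) auto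
    then obtain s' where s': "exec_within (While (Var (m + 1)) body) ?s4 ((length zs + 1) * poly step (size d)) s'"
      "s' (m + 2) = fold (f d) (l d) (i d)" "\<And>x. x \<ge> m + 3 \<Longrightarrow> s' x = ?s4 x"
      by blast
    have "exec_within (While (Var (m + 1)) body) s ((length (z # zs) + 1) * poly step (size d)) s'"
      by (rule exec_within_WhileTrue[OF _ body s'(1)])
        (use Cons.prems sz in \<open>simp_all add: step_def poly_pcompose algebra_simps\<close>)
    moreover have "s' x = s x" if "x \<ge> m + 3" for x
      using s'(3)[OF that] s2(3)[of x] that m by simp
    ultimately show ?case using s'(2) by blast
  qed

  have "runs c (m + 3) p (\<lambda>d. fold (f d) (l d) (i d))"
    unfolding runs_def
  proof
    fix s :: state
    let ?d = "s 0"
    let ?L = "poly lp (size ?d)" and ?Q = "poly q (size ?d)"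
    let ?s1 = "s(m := ?d)"
    obtain s2 where s2: "exec_within cl ?s1 (poly pl (size (?s1 0))) s2" "s2 0 = encode_list (l (?s1 0))"
      "\<And>x. ml \<le> x \<Longrightarrow> s2 x = ?s1 x"
      using runsE[OF rl, where s = "?s1"] by blast
    let ?s3 = "s2(m + 1 := encode_list (l ?d))"
    let ?s4 = "?s3(0 := ?d)"
    obtain s5 where s5: "exec_within ci ?s4 (poly pi (size (?s4 0))) s5" "s5 0 = i (?s4 0)"
      "\<And>x. mi \<le> x \<Longrightarrow> s5 x = ?s4 x"
      using runsE[OF ri, where s = "?s4"] by blast
    let ?s6 = "s5(m + 2 := i ?d)"
    have v: "s2 0 = encode_list (l ?d)" "s2 m = ?d" "s5 0 = i ?d" "s5 m = ?d"
      "s5 (m + 1) = encode_list (l ?d)"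
      using s2 s5 m by auto
    obtain s7 where s7: "exec_within (While (Var (m + 1)) body) ?s6 ((length (l ?d) + 1) * poly step (size ?d)) s7"
      "s7 (m + 2) = fold (f ?d) (l ?d) (i ?d)" "\<And>x. x \<ge> m + 3 \<Longrightarrow> s7 x = ?s6 x"
      using loop[of ?d "[]" "l ?d" ?s6] v by auto
    let ?s8 = "s7(0 := fold (f ?d) (l ?d) (i ?d))"
    have len: "(length (l ?d) + 1) * poly step (size ?d) \<le> (?L + 1) * poly step (size ?d)"
      using size_l[of ?d] by (intro mult_right_mono) (auto simp: size_encode_list)
    have si: "size (i ?d) \<le> ?Q" and sr: "size (fold (f ?d) (l ?d) (i ?d)) \<le> ?Q"
      using bound[of ?d "[]" "l ?d"] bound[of ?d "l ?d" "[]"] by simp_all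
    have 1: "exec_within (Assign m (Var 0)) s (2 + size ?d) ?s1"
      using exec_within_Assign[of "Var 0" s] by simp
    have 2: "exec_within cl ?s1 ?L s2"
      using s2(1) m unfolding exec_within_def lp_def by (auto intro: trans_le_add2)
    have 3: "exec_within (Assign (m + 1) (Var 0)) s2 (2 + ?L) ?s3"
      using exec_within_Assign[of "Var 0" s2 _ "m + 1"] v size_l[of ?d] by simp
    have 4: "exec_within (Assign 0 (Var m)) ?s3 (2 + size ?d) ?s4"
      using exec_within_Assign[of "Var m" ?s3 _ 0] v by simp
    have 5: "exec_within ci ?s4 (poly pi (size ?d)) s5"
      using s5(1) by simp
    have 6: "exec_within (Assign (m + 2) (Var 0)) s5 (2 + ?Q) ?s6"
      using exec_within_Assign[of "Var 0" s5 _ "m + 2"] v si by simp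
    have 7: "exec_within (While (Var (m + 1)) body) ?s6 ((?L + 1) * poly step (size ?d)) s7"
      using s7(1) len unfolding exec_within_def by (meson order_trans)
    have 8: "exec_within (Assign 0 (Var (m + 2))) s7 (2 + ?Q) ?s8"
      using exec_within_Assign[of "Var (m + 2)" s7 _ 0] s7(2) sr by simp
    have "exec_within c s (poly p (size ?d)) ?s8"
      unfolding c_def
      by (rule exec_within_Seq[OF 1 exec_within_Seq[OF 2 exec_within_Seq[OF 3 exec_within_Seq[OF 4
          exec_within_Seq[OF 5 exec_within_Seq[OF 6 exec_within_Seq[OF 7 8
          order_refl] order_refl] order_refl] order_refl] order_refl] order_refl]])
        (simp add: p_def)
    then show "\<exists>s'. exec_within c s (poly p (size (s 0))) s' \<and>
        s' 0 = fold (f (s 0)) (l (s 0)) (i (s 0)) \<and> (\<forall>x\<ge>m + 3. s' x = s x)"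
      using s2(3) s5(3) s7(3) m by (intro exI[of _ ?s8]) auto
  qed
  then show ?thesis unfolding ptime_def by blast
qed

text \<open>If each step adds an amount depending only on the input and the list entry, the total
  growth is at most the length of the list times the largest such amount; length and entries are
  bounded by the size of the encoded list.\<close>

lemma ptime_fold_additive:
  assumes l: "ptime (\<lambda>d. encode_list (l d))" and i: "ptime i"
    and f: "ptime (\<lambda>e. f (left e) (left (right e)) (right (right e)))"
    and growth: "\<And>d x a. size (f d x a) \<le> size a + poly q (size d + size x)"
  shows "ptime (\<lambda>d. fold (f d) (l d) (i d))"
proof -
  obtain ql where ql: "\<And>d. size (encode_list (l d)) \<le> poly ql (size d)"
    using ptime_size_bound[OF l] by blast
  obtain qi where qi: "\<And>d. size (i d) \<le> poly qi (size d)"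
    using ptime_size_bound[OF i] by blast
  have fold_le: "size (fold (f d) ys a) \<le> size a + length ys * K"
    if "\<And>x. x \<in> set ys \<Longrightarrow> poly q (size d + size x) \<le> K" for d ys a K
    using that
  proof (induction ys arbitrary: a)
    case (Cons y ys)
    have "size (fold (f d) ys (f d y a)) \<le> size (f d y a) + length ys * K"
      by (rule Cons.IH) (simp add: Cons.prems)
    moreover have "size (f d y a) \<le> size a + K"
      using growth[of d y a] Cons.prems[of y] by simp
    ultimately show ?case by simp
  qed simp
  have "size (fold (f d) ys (i d)) \<le> poly (qi + ql * pcompose q ([:0, 1:] + ql)) (size d)"
    if eq: "l d = ys @ zs" for d ys zs
  proof -
    have "size (fold (f d) ys (i d)) \<le> size (i d) + length ys * poly q (size d + poly ql (size d))"
      using ql[of d] eq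
      by (intro fold_le poly_nat_mono add_left_mono order_trans[OF size_le_size_encode_list ql]) auto
    also have "\<dots> \<le> poly qi (size d) + poly ql (size d) * poly q (size d + poly ql (size d))"
      using qi[of d] ql[of d] eq by (intro add_mono mult_right_mono) (auto simp: size_encode_list)
    finally show ?thesis by (simp add: poly_pcompose)
  qed
  with l i f show ?thesis by (rule ptime_fold)
qed

text \<open>Folding with \<open>Node\<close> conses the entries in reading order, which reverses
  them; map and filter below fold over the reversed list to preserve the order.\<close>

lemma ptime_rev:
  assumes "ptime (\<lambda>d. encode_list (l d))"
  shows "ptime (\<lambda>d. encode_list (rev (l d)))"
proof -
  have "ptime (\<lambda>d. fold Node (l d) Leaf)"
    by (rule ptime_fold_additive[where q = "[:1, 1:]" and f = "\<lambda>_. Node"])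
      (simp_all add: assms ptime_basic)
  moreover have "fold Node xs (encode_list ys) = encode_list (rev xs @ ys)" for xs ys
    by (induction xs arbitrary: ys) (simp_all flip: encode_list.simps)
  from this[of _ "[]"] have "fold Node xs Leaf = encode_list (rev xs)" for xs
    by simp
  ultimately show ?thesis by simp
qed

lemma ptime_if:
  assumes "ptime (\<lambda>d. encode_bool (P d))" "ptime f" "ptime g"
  shows "ptime (\<lambda>d. if P d then f d else g d)"
proof -
  have "encode_bool b \<noteq> Leaf \<longleftrightarrow> b" for b by (cases b) auto
  then show ?thesis using ptime_if_Leaf[OF assms] by simp
qed

lemma ptime_pair:
  assumes "ptime (\<lambda>e. f (left e) (right e))" "ptime a" "ptime b"
  shows "ptime (\<lambda>d. f (a d) (b d))"
  using ptime_comp[OF assms(1) ptime_Node[OF assms(2,3)]] by simp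

lemma ptime_map:
  assumes l: "ptime (\<lambda>d. encode_list (l d))" and f: "ptime (\<lambda>e. f (left e) (right e))"
  shows "ptime (\<lambda>d. encode_list (map (f d) (l d)))"
proof -
  obtain q where q: "\<And>e. size (f (left e) (right e)) \<le> poly q (size e)"
    using ptime_size_bound[OF f] by blast
  have "ptime (\<lambda>d. fold (\<lambda>x a. Node (f d x) a) (rev (l d)) Leaf)"
  proof (rule ptime_fold_additive[where q = "1 + pcompose q [:1, 1:]"])
    show "ptime (\<lambda>e. Node (f (left e) (left (right e))) (right (right e)))"
      by (intro ptime_pair[OF f] ptime_basic)
    show "size (Node (f d x) a) \<le> size a + poly (1 + pcompose q [:1, 1:]) (size d + size x)" for d x a
      using q[of "Node d x"] by (simp add: poly_pcompose)
  qed (simp_all add: ptime_rev[OF l] ptime_const)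
  moreover have "fold (\<lambda>x a. Node (f d x) a) (rev xs) Leaf = encode_list (map (f d) xs)" for d xs
    by (induction xs) auto
  ultimately show ?thesis by simp
qed

lemma ptime_filter:
  assumes l: "ptime (\<lambda>d. encode_list (l d))" and P: "ptime (\<lambda>e. encode_bool (P (left e) (right e)))"
  shows "ptime (\<lambda>d. encode_list (filter (P d) (l d)))"
proof -
  have "ptime (\<lambda>d. fold (\<lambda>x a. if P d x then Node x a else a) (rev (l d)) Leaf)"
  proof (rule ptime_fold_additive[where q = "[:1, 1:]"])
    show "ptime (\<lambda>e. if P (left e) (left (right e)) then Node (left (right e)) (right (right e))
        else right (right e))"
      by (intro ptime_if ptime_pair[OF P] ptime_basic)
  qed (simp_all add: ptime_rev[OF l] ptime_const)
  moreover have "fold (\<lambda>x a. if P d x then Node x a else a) (rev xs) Leaf = encode_list (filter (P d) xs)"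
    for d xs
    by (induction xs) auto
  ultimately show ?thesis by simp
qed

section \<open>Boolean connectives and bounded quantification\<close>

lemma ptime_nonleaf:
  assumes "ptime f"
  shows "ptime (\<lambda>d. encode_bool (f d \<noteq> Leaf))"
proof -
  have "(if f d \<noteq> Leaf then encode_bool True else encode_bool False) = encode_bool (f d \<noteq> Leaf)" for d
    by simp
  then show ?thesis
    using ptime_if_Leaf[OF assms ptime_const[of "encode_bool True"] ptime_const[of "encode_bool False"]]
    by (simp only:)
qed

lemma ptime_not:
  assumes "ptime (\<lambda>d. encode_bool (P d))"
  shows "ptime (\<lambda>d. encode_bool (\<not> P d))"
proof -
  have "(if P d then encode_bool False else encode_bool True) = encode_bool (\<not> P d)" for d
    by simp
  then show ?thesis
    using ptime_if[OF assms ptime_const[of "encode_bool False"] ptime_const[of "encode_bool True"]]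
    by (simp only:)
qed

lemma ptime_conj:
  assumes "ptime (\<lambda>d. encode_bool (P d))" "ptime (\<lambda>d. encode_bool (Q d))"
  shows "ptime (\<lambda>d. encode_bool (P d \<and> Q d))"
proof -
  have "(if P d then encode_bool (Q d) else encode_bool False) = encode_bool (P d \<and> Q d)" for d
    by simp
  then show ?thesis
    using ptime_if[OF assms ptime_const[of "encode_bool False"]] by (simp only:)
qed

lemma ptime_disj:
  assumes "ptime (\<lambda>d. encode_bool (P d))" "ptime (\<lambda>d. encode_bool (Q d))"
  shows "ptime (\<lambda>d. encode_bool (P d \<or> Q d))"
  using ptime_not[OF ptime_conj[OF assms[THEN ptime_not]]] by simp

text \<open>A bounded existential asks whether the filtered list is nonempty, that is, whether its
  code is not \<open>Leaf\<close>.\<close>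

lemma ptime_bex:
  assumes l: "ptime (\<lambda>d. encode_list (l d))" and P: "ptime (\<lambda>e. encode_bool (P (left e) (right e)))"
  shows "ptime (\<lambda>d. encode_bool (\<exists>x\<in>set (l d). P d x))"
proof -
  have "encode_list xs \<noteq> Leaf \<longleftrightarrow> xs \<noteq> []" for xs
    by (cases xs) auto
  then have "encode_list (filter (P d) (l d)) \<noteq> Leaf \<longleftrightarrow> (\<exists>x\<in>set (l d). P d x)" for d
    by (auto simp: filter_empty_conv)
  then show ?thesis
    using ptime_nonleaf[OF ptime_filter[OF assms]] by simp
qed

section \<open>Unary numbers as list indices\<close>

definition tree_drop :: "btree \<Rightarrow> btree \<Rightarrow> btree" where
  "tree_drop u t = fold (\<lambda>_. right) (decode_list u) t"

lemma ptime_tree_drop: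
  assumes "ptime a" "ptime b"
  shows "ptime (\<lambda>d. tree_drop (a d) (b d))"
  unfolding tree_drop_def
proof (rule ptime_fold_additive[where f = "\<lambda>_ _. right" and q = 0])
  have "size (right t) \<le> size t" for t by (cases t) auto
  then show "size (right t) \<le> size t + poly 0 (size d + size x)" for t d x :: btree
    by simp
  show "ptime (\<lambda>e. right (right (right e)))"
    by (intro ptime_basic)
qed (simp_all add: assms)

text \<open>A numeral is a right spine, and itself a list, so \<open>tree_drop\<close> serves both
  to index into lists and to subtract.\<close>

definition unary :: "nat \<Rightarrow> btree" where
  "unary n = encode_list (replicate n Leaf)"

lemma tree_drop_unary [simp]: "tree_drop (unary n) (encode_list xs) = encode_list (drop n xs)"
proof (induction n arbitrary: xs)
  case (Suc n)
  have "tree_drop (unary (Suc n)) t = tree_drop (unary n) (right t)" for t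
    by (simp add: tree_drop_def unary_def)
  moreover have "right (encode_list xs) = encode_list (tl xs)"
    by (cases xs) auto
  ultimately show ?case
    using Suc.IH[of "tl xs"] by (simp add: drop_Suc)
qed (simp add: tree_drop_def unary_def)

lemma tree_drop_unary_unary [simp]: "tree_drop (unary m) (unary n) = unary (n - m)"
  using tree_drop_unary[of m "replicate n Leaf"] by (simp flip: unary_def)

lemma left_encode_list: "left (encode_list xs) = (case xs of [] \<Rightarrow> Leaf | x # _ \<Rightarrow> x)"
  by (cases xs) auto

lemma unary_eq_Leaf [simp]: "unary n = Leaf \<longleftrightarrow> n = 0"
  by (cases n) (auto simp: unary_def)

lemma size_unary [simp]: "size (unary n) = n"
  by (simp add: unary_def size_encode_list sum_list_replicate)

definition unary_upto :: "btree \<Rightarrow> btree list" where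
  "unary_upto t = map unary (rev [0..<length (decode_list t)])"

text \<open>The accumulator is a descending list of numerals; each step puts the successor of its
  head in front. Starting from the code of the list with the single entry 0, one numeral too many
  arises, and \<open>right\<close> removes it.\<close>

lemma ptime_unary_upto:
  assumes "ptime a"
  shows "ptime (\<lambda>d. encode_list (unary_upto (a d)))"
proof -
  let ?f = "\<lambda>(_::btree) (_::btree) acc. Node (Node Leaf (left acc)) acc"
  have fold_eq: "fold (?f d) xs (Node Leaf Leaf) = encode_list (map unary (rev [0..<Suc (length xs)]))" for d xs
  proof (induction xs rule: rev_induct)
    case (snoc x xs)
    have "Node Leaf (unary n) = unary (Suc n)" for n by (simp add: unary_def)
    with snoc show ?case by simp
  qed (simp add: unary_def)
  have bound: "size (encode_list (map unary (rev [0..<n]))) \<le> n + n * n" for n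
    by (induction n) auto
  \<comment> \<open>Each step copies the head of the accumulator, so the growth is not controlled by
    the input and the entry alone. With \<open>k = size d + 1\<close>, the bound is
    \<open>k + k * k\<close>, that is, \<open>2 + 3 * size d + size d ^ 2\<close>.\<close>
  have "ptime (\<lambda>t. fold (?f t) (decode_list t) (Node Leaf Leaf))"
  proof (rule ptime_fold[where q = "[:2, 3, 1:]"])
    fix d ys zs assume "decode_list d = ys @ zs"
    then have "length ys \<le> size d"
      using length_decode_list_le[of d] by simp
    then have "Suc (length ys) + Suc (length ys) * Suc (length ys) \<le> Suc (size d) + Suc (size d) * Suc (size d)"
      by (intro add_mono mult_mono) auto
    then show "size (fold (?f d) ys (Node Leaf Leaf)) \<le> poly [:2, 3, 1:] (size d)"
      unfolding fold_eq using bound[of "Suc (length ys)"] by (simp add: algebra_simps)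
  qed (use ptime_basic in simp_all)
  then have "ptime (\<lambda>t. right (fold (?f t) (decode_list t) (Node Leaf Leaf)))"
    by (rule ptime_right)
  then have "ptime (\<lambda>t. encode_list (unary_upto t))"
    unfolding fold_eq by (simp add: unary_upto_def)
  then show ?thesis using assms by (rule ptime_comp)
qed

section \<open>Separations of twin-covered graphs\<close>

definition separation :: "'a set \<Rightarrow> ('a \<Rightarrow> 'a \<Rightarrow> bool) \<Rightarrow> 'a set \<Rightarrow> 'a set \<Rightarrow> bool" where
  "separation V E A B \<longleftrightarrow> A \<subseteq> V \<and> B \<subseteq> V \<and> A \<noteq> {} \<and> B \<noteq> {} \<and> A \<inter> B = {} \<and>
     (\<forall>a\<in>A. \<forall>b\<in>B. \<not> E a b) \<and> (\<forall>u\<in>V - A - B. \<forall>v\<in>V - A - B. \<not> E u v)"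

definition separable :: "'a set \<Rightarrow> ('a \<Rightarrow> 'a \<Rightarrow> bool) \<Rightarrow> bool" where
  "separable V E \<longleftrightarrow> (\<exists>A B. separation V E A B)"

text \<open>The sides of a separation may be unions of components. From a cutset, one component is
  taken against all other remaining vertices; conversely, reachability in the remaining graph cannot
  leave the side \<open>A\<close>.\<close>

lemma ex_stable_cutset_iff:
  assumes "pair_graph G"
  shows "(\<exists>S. stable_cutset G S) \<longleftrightarrow> separable (pverts G) (\<lambda>u v. (u, v) \<in> parcs G)"
proof
  interpret pair_graph G by fact
  assume "\<exists>S. stable_cutset G S"
  then obtain S where S: "S \<subseteq> pverts G" "\<forall>u\<in>S. \<forall>v\<in>S. (u, v) \<notin> parcs G"
    and c: "2 \<le> card (pre_digraph.sccs_verts (with_proj G \<restriction> (pverts G - S)))"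
    unfolding stable_cutset_def by blast
  have ind: "induced_subgraph (with_proj G \<restriction> (pverts G - S)) (with_proj G)"
    by (rule induced_induce) auto
  interpret H: digraph "with_proj G \<restriction> (pverts G - S)"
    by (rule digraphI_induced[OF ind])
  interpret H: sym_digraph "with_proj G \<restriction> (pverts G - S)"
    by (rule induced_graph_imp_graph[OF ind])
  obtain A B where AB: "A \<in> H.sccs_verts" "B \<in> H.sccs_verts" "A \<noteq> B"
    using c by (metis card_le_Suc0_iff_eq card.infinite not_less_eq_eq numeral_2_eq_2 zero_le)
  have sub: "A \<subseteq> pverts G - S" "B \<subseteq> pverts G - S"
    using AB(1,2)[THEN H.sccs_verts_subsets] by auto
  have ne: "A \<noteq> {}" "B \<noteq> {}" "A \<inter> B = {}"
    using AB H.sccs_verts_disjoint by (auto simp: H.in_sccs_verts_conv_reachable)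
  \<comment> \<open>An arc makes its ends mutually reachable, hence members of the same
    component.\<close>
  have no_arc: "(a, b) \<notin> parcs G" if "a \<in> A" "b \<in> pverts G - S - A" for a b
  proof
    assume "(a, b) \<in> parcs G"
    then have "(a, b) \<in> arcs_ends (with_proj G \<restriction> (pverts G - S))"
      using that sub by (auto simp: arcs_ends_def arc_to_ends_def)
    then have "a \<rightarrow>\<^sup>*\<^bsub>with_proj G \<restriction> (pverts G - S)\<^esub> b"
      by (rule H.reachable_adjI)
    moreover from this have "b \<rightarrow>\<^sup>*\<^bsub>with_proj G \<restriction> (pverts G - S)\<^esub> a"
      by (rule H.symmetric_reachable')
    ultimately show False
      using AB(1) that by (auto simp: H.in_sccs_verts_conv_reachable)
  qed
  have "separation (pverts G) (\<lambda>u v. (u, v) \<in> parcs G) A (pverts G - S - A)"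
    unfolding separation_def using sub ne no_arc S by blast
  then show "separable (pverts G) (\<lambda>u v. (u, v) \<in> parcs G)"
    unfolding separable_def by blast
next
  interpret pair_graph G by fact
  assume "separable (pverts G) (\<lambda>u v. (u, v) \<in> parcs G)"
  then obtain A B where sep: "separation (pverts G) (\<lambda>u v. (u, v) \<in> parcs G) A B"
    unfolding separable_def by blast
  define S where "S = pverts G - A - B"
  have ind: "induced_subgraph (with_proj G \<restriction> (pverts G - S)) (with_proj G)"
    by (rule induced_induce) auto
  interpret H: digraph "with_proj G \<restriction> (pverts G - S)"
    by (rule digraphI_induced[OF ind])
  interpret H: sym_digraph "with_proj G \<restriction> (pverts G - S)"
    by (rule induced_graph_imp_graph[OF ind])
  obtain a b where ab: "a \<in> A" "b \<in> B"
    using sep unfolding separation_def by blast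
  have V: "pverts G - S = A \<union> B"
    using sep unfolding separation_def S_def by blast
  have inv: "v \<in> A" if "a \<rightarrow>\<^sup>*\<^bsub>with_proj G \<restriction> (pverts G - S)\<^esub> v" for v
    using that
  proof (induction rule: H.reachable_induct)
    case base
    then show ?case using ab by simp
  next
    case (step x y)
    then have "(x, y) \<in> parcs G" "y \<in> A \<union> B"
      using V by (auto simp: arcs_ends_def arc_to_ends_def)
    then show ?case using sep step unfolding separation_def by blast
  qed
  have "b \<notin> H.scc_of a"
    using inv ab sep unfolding H.scc_of_def separation_def by blast
  moreover have "b \<in> H.scc_of b"
    using ab V by (intro H.in_scc_of_self) auto
  ultimately have "H.scc_of a \<noteq> H.scc_of b" by blast
  moreover have "{H.scc_of a, H.scc_of b} \<subseteq> H.sccs_verts"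
    using ab V by (intro insert_subsetI empty_subsetI H.scc_of_in_sccs_verts) auto
  ultimately have "2 \<le> card H.sccs_verts"
    using card_mono[OF H.finite_sccs_verts, of "{H.scc_of a, H.scc_of b}"] by simp
  then have "stable_cutset G S"
    using sep unfolding stable_cutset_def separation_def S_def by auto
  then show "\<exists>S. stable_cutset G S" by blast
qed

text \<open>Images and preimages carry separations over; this is used to rename the kept vertices to
  list positions.\<close>

lemma separable_bij:
  assumes h: "bij_betw h V W" and E: "\<And>u v. u \<in> V \<Longrightarrow> v \<in> V \<Longrightarrow> E u v \<longleftrightarrow> F (h u) (h v)"
  shows "separable V E \<longleftrightarrow> separable W F"
proof
  have inj: "inj_on h V" and img: "h ` V = W"
    using h by (auto simp: bij_betw_def)
  {
    assume "separable V E"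
    then obtain A B where s: "separation V E A B" unfolding separable_def by blast
    have "separation W F (h ` A) (h ` B)"
      unfolding separation_def
    proof (intro conjI ballI)
      show "h ` A \<inter> h ` B = {}"
        using s inj unfolding separation_def by (simp flip: inj_on_image_Int)
      fix u v
      show "\<not> F u v" if "u \<in> W - h ` A - h ` B" "v \<in> W - h ` A - h ` B"
        using that s E unfolding separation_def img[symmetric] by blast
      show "\<not> F u v" if "u \<in> h ` A" "v \<in> h ` B"
        using that s E unfolding separation_def by blast
    qed (use s img in \<open>auto simp: separation_def\<close>)
    then show "separable W F" unfolding separable_def by blast
  next
    assume "separable W F"
    then obtain A B where s: "separation W F A B" unfolding separable_def by blast
    have "separation V E {v \<in> V. h v \<in> A} {v \<in> V. h v \<in> B}"
      using s E img unfolding separation_def by blast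
    then show "separable V E" unfolding separable_def by blast
  }
qed

text \<open>
  The vertex set \<open>V\<close>, the twin cover \<open>X\<close>, the adjacency \<open>E\<close> and the vertex order \<open>L\<close> are parameters
  of the following notions because the algorithm evaluates them on an encoded graph, whose
  vertices are trees.
\<close>

definition early_separable :: "'a set \<Rightarrow> ('a \<Rightarrow> bool) \<Rightarrow> ('a \<Rightarrow> 'a \<Rightarrow> bool) \<Rightarrow> ('a \<Rightarrow> 'a \<Rightarrow> bool) \<Rightarrow> bool" where
  "early_separable V X E L \<longleftrightarrow> (\<exists>v\<in>V. \<not> X v \<and> (\<exists>w\<in>V. (L v w \<or> L w v) \<and> \<not> E v w) \<and>
     \<not> (\<exists>x\<in>V. X x \<and> E v x \<and> (\<exists>y\<in>V. X y \<and> E v y \<and> E x y)))"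

text \<open>By the twin cover condition, an outside neighbour of an outside vertex is a twin of
  it.\<close>

definition has_twin :: "'a set \<Rightarrow> ('a \<Rightarrow> bool) \<Rightarrow> ('a \<Rightarrow> 'a \<Rightarrow> bool) \<Rightarrow> 'a \<Rightarrow> bool" where
  "has_twin V X E v \<longleftrightarrow> (\<exists>u\<in>V. \<not> X u \<and> E v u)"

definition is_first :: "'a set \<Rightarrow> ('a \<Rightarrow> 'a \<Rightarrow> bool) \<Rightarrow> ('a \<Rightarrow> bool) \<Rightarrow> 'a \<Rightarrow> bool" where
  "is_first V L P v \<longleftrightarrow> P v \<and> \<not> (\<exists>u\<in>V. L u v \<and> P u)"

text \<open>Besides the cover, this keeps a witness for each triple of cover vertices, a witness
  with a twin for each pair, and a twin of the latter, so that it still has one among the kept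
  vertices. Taking first witnesses makes them unique, hence few.\<close>

definition kept :: "'a set \<Rightarrow> ('a \<Rightarrow> bool) \<Rightarrow> ('a \<Rightarrow> 'a \<Rightarrow> bool) \<Rightarrow> ('a \<Rightarrow> 'a \<Rightarrow> bool) \<Rightarrow> 'a \<Rightarrow> bool" where
  "kept V X E L v \<longleftrightarrow> X v \<or> (\<exists>x\<in>V. X x \<and> (\<exists>y\<in>V. X y \<and>
     ((\<exists>z\<in>V. X z \<and> is_first V L (\<lambda>u. \<not> X u \<and> E u x \<and> E u y \<and> E u z) v) \<or>
      is_first V L (\<lambda>u. \<not> X u \<and> has_twin V X E u \<and> E u x \<and> E u y) v \<or>
      (\<exists>w\<in>V. is_first V L (\<lambda>u. \<not> X u \<and> has_twin V X E u \<and> E u x \<and> E u y) w \<and>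
        is_first V L (\<lambda>u. \<not> X u \<and> E w u) v))))"

lemma ex_is_first:
  fixes v :: "'a::wellorder"
  assumes "v \<in> V" "P v"
  obtains w where "w \<in> V" "is_first V (<) P w"
  using LeastI[of "\<lambda>v. v \<in> V \<and> P v" v] not_less_Least[of _ "\<lambda>v. v \<in> V \<and> P v"] assms
  unfolding is_first_def by blast

lemma is_first_unique:
  fixes v w :: "'a::linorder"
  assumes "is_first V (<) P v" "v \<in> V" "is_first V (<) P w" "w \<in> V"
  shows "v = w"
  using assms unfolding is_first_def by (cases v w rule: linorder_cases) auto

text \<open>
  A separation of the twin cover alone extends to the whole graph iff no vertex outside is forced
  onto both sides: a vertex seeing both sides must be removed, which is impossible if it has a
  twin or a neighbour that is removed too.
\<close>

definition extendable :: "'a set \<Rightarrow> ('a \<Rightarrow> bool) \<Rightarrow> ('a \<Rightarrow> 'a \<Rightarrow> bool) \<Rightarrow> 'a set \<Rightarrow> 'a set \<Rightarrow> bool" where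
  "extendable V X E A B \<longleftrightarrow> separation {x \<in> V. X x} E A B \<and>
     (\<forall>v\<in>V. \<not> X v \<longrightarrow> \<not> (\<exists>x\<in>A. \<exists>y\<in>B. has_twin V X E v \<and> E v x \<and> E v y)) \<and>
     (\<forall>v\<in>V. \<not> X v \<longrightarrow> \<not> (\<exists>x\<in>A. \<exists>y\<in>B. \<exists>z\<in>{x \<in> V. X x} - A - B. E v x \<and> E v y \<and> E v z))"

section \<open>Extending separations beyond the twin cover\<close>

locale twin_covered =
  fixes V :: "'a::wellorder set" and X :: "'a \<Rightarrow> bool" and E :: "'a \<Rightarrow> 'a \<Rightarrow> bool"
  assumes sym: "E u v \<Longrightarrow> E v u"
    and twins: "\<lbrakk>u \<in> V; v \<in> V; \<not> X u; \<not> X v; E u v; w \<in> V; w \<noteq> v; E u w\<rbrakk> \<Longrightarrow> E v w"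
begin

text \<open>The clique of \<open>v\<close> outside the cover is separated from the non-neighbours of
  \<open>v\<close>; what remains are the cover neighbours of \<open>v\<close>, which are stable. The
  two order alternatives in the definition express \<open>v \<noteq> w\<close>.\<close>

lemma early_separableD:
  assumes "early_separable V X E (<)"
  shows "separable V E"
proof -
  obtain v w where v: "v \<in> V" "\<not> X v" and w: "w \<in> V" "v \<noteq> w" "\<not> E v w"
    and st: "\<And>x y. \<lbrakk>x \<in> V; y \<in> V; X x; X y; E v x; E v y\<rbrakk> \<Longrightarrow> \<not> E x y"
    using assms unfolding early_separable_def by blast
  let ?A = "{u \<in> V. \<not> X u \<and> (u = v \<or> E v u)}" and ?B = "{u \<in> V. u \<noteq> v \<and> \<not> E v u}"
  have "\<not> E a b" if "a \<in> ?A" "b \<in> ?B" for a b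
    using that v twins[of a v b] sym by blast
  then have "separation V E ?A ?B"
    unfolding separation_def using v w st by blast
  then show ?thesis unfolding separable_def by blast
qed

lemma separation_extendable:
  assumes early: "\<not> early_separable V X E (<)" and sep: "separation V E A B"
  shows "extendable V X E {x \<in> A. X x} {x \<in> B. X x}"
proof -
  have sub: "A \<subseteq> V" "B \<subseteq> V" "A \<inter> B = {}"
    and no_edge: "\<And>a b. \<lbrakk>a \<in> A; b \<in> B\<rbrakk> \<Longrightarrow> \<not> E a b"
    and stable: "\<And>u v. \<lbrakk>u \<in> V - A - B; v \<in> V - A - B\<rbrakk> \<Longrightarrow> \<not> E u v"
    using sep unfolding separation_def by auto
  \<comment> \<open>If all cover neighbours of an outside vertex are removed, they are stable, so
    without early separability the vertex sees every other vertex.\<close>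
  have near: "w = v \<or> E v w"
    if "v \<in> V" "\<not> X v" "w \<in> V" "\<And>x. \<lbrakk>x \<in> V; X x; E v x\<rbrakk> \<Longrightarrow> x \<in> V - A - B" for v w
  proof (rule ccontr)
    assume "\<not> (w = v \<or> E v w)"
    then have "v < w \<or> w < v" "\<not> E v w" by auto
    then have "early_separable V X E (<)"
      unfolding early_separable_def using that stable by blast
    with early show False by blast
  qed
  obtain a b where ab: "a \<in> A" "b \<in> B"
    using sep unfolding separation_def by blast
  \<comment> \<open>If \<open>A\<close> missed \<open>X\<close>, the cover neighbours of
    \<open>a\<close> would lie on neither side, and \<open>near\<close> would join \<open>a\<close>
    to \<open>b\<close>.\<close>
  have "\<exists>x\<in>A. X x"
  proof (rule ccontr)
    assume "\<not> (\<exists>x\<in>A. X x)"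
    then have "b = a \<or> E a b"
      using ab sub sym by (intro near) (auto dest: no_edge)
    then show False using ab sub no_edge by blast
  qed
  moreover have "\<exists>x\<in>B. X x"
  proof (rule ccontr)
    assume "\<not> (\<exists>x\<in>B. X x)"
    then have "a = b \<or> E b a"
      using ab sub by (intro near) (auto dest: no_edge sym)
    then show False using ab sub no_edge sym by blast
  qed
  ultimately have "separation {x \<in> V. X x} E {x \<in> A. X x} {x \<in> B. X x}"
    using sep unfolding separation_def by auto
  \<comment> \<open>A vertex seeing both sides is removed. Its twin sees the same two cover
    vertices, so it would be removed as well, although the two are adjacent.\<close>
  moreover have "\<not> (has_twin V X E v \<and> E v x \<and> E v y)"
    if "v \<in> V" "\<not> X v" "x \<in> A" "X x" "y \<in> B" "X y" for v x y
  proof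
    assume H: "has_twin V X E v \<and> E v x \<and> E v y"
    then obtain u where u: "u \<in> V" "\<not> X u" "E v u"
      unfolding has_twin_def by blast
    have "v \<in> V - A - B"
      using H that no_edge sym by blast
    moreover have "E u x" "E u y"
      using that sub u H by (auto intro: twins[of v u])
    then have "u \<in> V - A - B"
      using u that no_edge sym by blast
    ultimately show False
      using stable u(3) by blast
  qed
  moreover have "\<not> (E v x \<and> E v y \<and> E v z)"
    if "v \<in> V" "x \<in> A" "y \<in> B" "z \<in> V - A - B" for v x y z
  proof
    assume H: "E v x \<and> E v y \<and> E v z"
    then have "v \<in> V - A - B"
      using that no_edge sym by blast
    then show False using H that stable by blast
  qed
  ultimately show ?thesis
    unfolding extendable_def by blast
qed

lemma extendable_separable:
  assumes "extendable V X E A B"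
  shows "separable V E"
proof -
  have sub: "A \<subseteq> {x \<in> V. X x}" "B \<subseteq> {x \<in> V. X x}" "A \<inter> B = {}" "A \<noteq> {}" "B \<noteq> {}"
    and no_edge: "\<And>a b. \<lbrakk>a \<in> A; b \<in> B\<rbrakk> \<Longrightarrow> \<not> E a b"
    and stable: "\<And>u v. \<lbrakk>u \<in> {x \<in> V. X x} - A - B; v \<in> {x \<in> V. X x} - A - B\<rbrakk> \<Longrightarrow> \<not> E u v"
    and no_twin: "\<And>v x y. \<lbrakk>v \<in> V; \<not> X v; x \<in> A; y \<in> B; E v x; E v y\<rbrakk> \<Longrightarrow> \<not> has_twin V X E v"
    and triple: "\<And>v x y z. \<lbrakk>v \<in> V; \<not> X v; x \<in> A; y \<in> B; z \<in> {x \<in> V. X x} - A - B; E v x; E v y\<rbrakk> \<Longrightarrow> \<not> E v z"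
    using assms unfolding extendable_def separation_def by blast+
  \<comment> \<open>An outside vertex joins \<open>A\<close> if it does not see \<open>B\<close>,
    joins \<open>B\<close> if it sees \<open>B\<close> but not \<open>A\<close>, and is removed if
    it sees both.\<close>
  let ?A = "A \<union> {v \<in> V. \<not> X v \<and> \<not> (\<exists>b\<in>B. E v b)}"
  let ?B = "B \<union> {v \<in> V. \<not> X v \<and> (\<exists>b\<in>B. E v b) \<and> \<not> (\<exists>a\<in>A. E v a)}"
  have AB: "\<not> E a b" if a: "a \<in> ?A" and b: "b \<in> ?B" for a b
  proof
    assume E: "E a b"
    consider "a \<in> A" "b \<in> B" | "a \<in> A" "b \<notin> B" | "a \<notin> A" "b \<in> B" | "a \<notin> A" "b \<notin> B" by blast
    then show False
    proof cases
      \<comment> \<open>Both ends lie outside \<open>X\<close> and are twins, so \<open>a\<close>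
        sees whatever \<open>b\<close> sees in \<open>B\<close>, which membership in
        \<open>?A\<close> excludes.\<close>
      case 4
      then obtain y where "y \<in> B" "E b y" "a \<in> V" "b \<in> V" "\<not> X a" "\<not> X b" "\<not> E a y"
        using a b by blast
      then show False using twins[of b a y] E sub sym by blast
    qed (use a b E no_edge sym in blast)+
  qed
  \<comment> \<open>A removed outside vertex sees both sides: an edge to a removed cover vertex
    would complete a forbidden triple, an edge to an outside vertex would supply a twin.\<close>
  have rest: "\<not> E u v" if u: "u \<in> V - ?A - ?B" and v: "v \<in> V - ?A - ?B" for u v
  proof
    assume E: "E u v"
    consider "X u" "X v" | "\<not> X u" "X v" | "X u" "\<not> X v" | "\<not> X u" "\<not> X v" by blast
    then show False
    proof cases
      case 1
      then show False using u v E stable by blast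
    next
      case 2
      then obtain x y where "x \<in> A" "y \<in> B" "E u x" "E u y" using u by blast
      then show False using triple[of u x y v] 2 u v E by blast
    next
      case 3
      then obtain x y where "x \<in> A" "y \<in> B" "E v x" "E v y" using v by blast
      then show False using triple[of v x y u] 3 u v E sym by blast
    next
      case 4
      then obtain x y where "x \<in> A" "y \<in> B" "E u x" "E u y" using u by blast
      then show False using no_twin[of u x y] 4 u v E unfolding has_twin_def by blast
    qed
  qed
  have "?A \<subseteq> V" "?B \<subseteq> V" "?A \<noteq> {}" "?B \<noteq> {}" "?A \<inter> ?B = {}"
    using sub by auto
  then have "separation V E ?A ?B"
    unfolding separation_def using AB rest by (intro conjI ballI) assumption+
  then show ?thesis unfolding separable_def by blast
qed

lemma separable_iff_extendable:
  assumes "\<not> early_separable V X E (<)"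
  shows "separable V E \<longleftrightarrow> (\<exists>A B. extendable V X E A B)"
  using separation_extendable[OF assms] extendable_separable unfolding separable_def by blast

lemma twin_covered_subset: "K \<subseteq> V \<Longrightarrow> twin_covered K X E"
  using sym twins by unfold_locales blast+

text \<open>Extendability depends only on the cover and on the existence of violating outside
  vertices, and the kept vertices contain a violator for each pair or triple that has one.\<close>

lemma separable_kept:
  assumes early: "\<not> early_separable V X E (<)"
  shows "separable {v \<in> V. kept V X E (<) v} E \<longleftrightarrow> separable V E"
proof -
  let ?K = "{v \<in> V. kept V X E (<) v}"
  have K: "{x \<in> ?K. X x} = {x \<in> V. X x}"
    by (auto simp: kept_def)
  \<comment> \<open>The kept vertices include the cover, so cover neighbourhoods are unchanged, and
    any kept non-neighbour is also one in \<open>V\<close>.\<close>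
  have early': "\<not> early_separable ?K X E (<)"
    using early K unfolding early_separable_def by blast
  interpret K: twin_covered ?K X E
    by (rule twin_covered_subset) blast
  have pair: "\<exists>v\<in>?K. \<not> X v \<and> has_twin ?K X E v \<and> E v x \<and> E v y"
    if vxy: "v \<in> V" "\<not> X v" "has_twin V X E v" "E v x" "E v y" "x \<in> V" "X x" "y \<in> V" "X y" for v x y
  proof -
    let ?P = "\<lambda>u. \<not> X u \<and> has_twin V X E u \<and> E u x \<and> E u y"
    obtain w where w: "w \<in> V" "is_first V (<) ?P w"
      using ex_is_first[of v V ?P] vxy by blast
    then have Pw: "?P w" unfolding is_first_def by blast
    then obtain u' where "u' \<in> V" "\<not> X u' \<and> E w u'" unfolding has_twin_def by blast
    \<comment> \<open>The first outside neighbour of \<open>w\<close> is kept as well and certifies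
      that \<open>w\<close> has a twin among the kept vertices.\<close>
    then obtain u where u: "u \<in> V" "is_first V (<) (\<lambda>u. \<not> X u \<and> E w u) u"
      using ex_is_first[of u' V "\<lambda>u. \<not> X u \<and> E w u"] by blast
    have "w \<in> ?K" "u \<in> ?K"
      using w u vxy unfolding kept_def by blast+
    moreover have "\<not> X u" "E w u"
      using u(2) unfolding is_first_def by auto
    ultimately show ?thesis
      using Pw unfolding has_twin_def by blast
  qed
  have triple: "\<exists>v\<in>?K. \<not> X v \<and> E v x \<and> E v y \<and> E v z"
    if vxyz: "v \<in> V" "\<not> X v" "E v x" "E v y" "E v z" "x \<in> V" "X x" "y \<in> V" "X y" "z \<in> V" "X z" for v x y z
  proof -
    let ?P = "\<lambda>u. \<not> X u \<and> E u x \<and> E u y \<and> E u z"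
    obtain w where w: "w \<in> V" "is_first V (<) ?P w"
      using ex_is_first[of v V ?P] vxyz by blast
    have "w \<in> ?K"
      using w vxyz unfolding kept_def by blast
    then show ?thesis
      using w(2) unfolding is_first_def by blast
  qed
  have "extendable ?K X E A B \<longleftrightarrow> extendable V X E A B" for A B
  proof
    assume ext: "extendable ?K X E A B"
    then have sub: "A \<subseteq> {x \<in> V. X x}" "B \<subseteq> {x \<in> V. X x}"
      unfolding extendable_def separation_def K by auto
    show "extendable V X E A B"
      unfolding extendable_def
    proof (intro conjI ballI impI notI)
      show "separation {x \<in> V. X x} E A B"
        using ext unfolding extendable_def K by blast
    next
      fix v assume "v \<in> V" "\<not> X v" "\<exists>x\<in>A. \<exists>y\<in>B. has_twin V X E v \<and> E v x \<and> E v y"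
      then obtain x y where xy: "x \<in> A" "y \<in> B" "has_twin V X E v" "E v x" "E v y" by blast
      then have "\<exists>v\<in>?K. \<not> X v \<and> has_twin ?K X E v \<and> E v x \<and> E v y"
        using \<open>v \<in> V\<close> \<open>\<not> X v\<close> sub by (intro pair) auto
      then show False
        using ext xy unfolding extendable_def by blast
    next
      fix v assume "v \<in> V" "\<not> X v"
        "\<exists>x\<in>A. \<exists>y\<in>B. \<exists>z\<in>{x \<in> V. X x} - A - B. E v x \<and> E v y \<and> E v z"
      then obtain x y z where xyz: "x \<in> A" "y \<in> B" "z \<in> {x \<in> V. X x} - A - B" "E v x" "E v y" "E v z"
        by blast
      then have "\<exists>v\<in>?K. \<not> X v \<and> E v x \<and> E v y \<and> E v z"
        using \<open>v \<in> V\<close> \<open>\<not> X v\<close> sub by (intro triple) auto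
      then show False
        using ext xyz unfolding extendable_def K by blast
    qed
  next
    assume ext: "extendable V X E A B"
    have "has_twin V X E v" if "has_twin ?K X E v" for v
      using that unfolding has_twin_def by blast
    then show "extendable ?K X E A B"
      using ext unfolding extendable_def K by blast
  qed
  then show ?thesis
    using separable_iff_extendable[OF early] K.separable_iff_extendable[OF early'] by simp
qed

end

section \<open>Counting the kept vertices\<close>

lemma card_kept_le:
  fixes V :: "'a::wellorder set"
  assumes "finite V"
  shows "card {v \<in> V. kept V X E (<) v} \<le> 4 * card {x \<in> V. X x} ^ 3"
proof -
  define C where "C = {x \<in> V. X x}"
  \<comment> \<open>First vertices are unique, so each is a function of the property it satisfies
    first.\<close>
  define first where "first P = (SOME v. v \<in> V \<and> is_first V (<) P v)" for P
  have first: "v = first P" if "v \<in> V" "is_first V (<) P v" for P v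
    using is_first_unique[OF that(2,1)] that someI[of "\<lambda>v. v \<in> V \<and> is_first V (<) P v" v]
    unfolding first_def by blast
  define f where "f = (\<lambda>(x, y, z). first (\<lambda>u. \<not> X u \<and> E u x \<and> E u y \<and> E u z))"
  define g where "g = (\<lambda>(x, y). first (\<lambda>u. \<not> X u \<and> has_twin V X E u \<and> E u x \<and> E u y))"
  \<comment> \<open>The kept twin depends on the pair alone, through the witness
    \<open>g e\<close>.\<close>
  define h where "h = (\<lambda>e. first (\<lambda>u. \<not> X u \<and> E (g e) u))"
  have "{v \<in> V. kept V X E (<) v} \<subseteq> C \<union> f ` (C \<times> C \<times> C) \<union> g ` (C \<times> C) \<union> h ` (C \<times> C)"
  proof
    fix v assume "v \<in> {v \<in> V. kept V X E (<) v}"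
    then have v: "v \<in> V" "kept V X E (<) v" by auto
    from v(2) consider "X v"
      | x y z where "x \<in> C" "y \<in> C" "z \<in> C"
          "is_first V (<) (\<lambda>u. \<not> X u \<and> E u x \<and> E u y \<and> E u z) v"
      | x y where "x \<in> C" "y \<in> C"
          "is_first V (<) (\<lambda>u. \<not> X u \<and> has_twin V X E u \<and> E u x \<and> E u y) v"
      | x y w where "x \<in> C" "y \<in> C" "w \<in> V"
          "is_first V (<) (\<lambda>u. \<not> X u \<and> has_twin V X E u \<and> E u x \<and> E u y) w"
          "is_first V (<) (\<lambda>u. \<not> X u \<and> E w u) v"
      unfolding kept_def C_def by blast
    then show "v \<in> C \<union> f ` (C \<times> C \<times> C) \<union> g ` (C \<times> C) \<union> h ` (C \<times> C)"
    proof cases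
      case 1
      then show ?thesis using v by (simp add: C_def)
    next
      case (2 x y z)
      then have "v = f (x, y, z)" using first[OF v(1)] by (simp add: f_def)
      then show ?thesis using 2 by blast
    next
      case (3 x y)
      then have "v = g (x, y)" using first[OF v(1)] by (simp add: g_def)
      then show ?thesis using 3 by blast
    next
      case (4 x y w)
      then have "w = g (x, y)" using first[OF 4(3)] by (simp add: g_def)
      with 4 have "v = h (x, y)" using first[OF v(1)] by (simp add: h_def)
      then show ?thesis using 4 by blast
    qed
  qed
  moreover have fin: "finite C" using assms by (simp add: C_def)
  ultimately have "card {v \<in> V. kept V X E (<) v} \<le>
      card (C \<union> f ` (C \<times> C \<times> C) \<union> g ` (C \<times> C) \<union> h ` (C \<times> C))"
    by (intro card_mono) auto
  also have "\<dots> \<le> card C + card (f ` (C \<times> C \<times> C)) + card (g ` (C \<times> C)) + card (h ` (C \<times> C))"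
    by (intro order_trans[OF card_Un_le] add_right_mono order_refl)
  also have "\<dots> \<le> card C + card C ^ 3 + card C ^ 2 + card C ^ 2"
    using fin card_image_le[of "C \<times> C \<times> C" f] card_image_le[of "C \<times> C" g] card_image_le[of "C \<times> C" h]
    by (intro add_mono) (auto simp: card_cartesian_product power2_eq_square power3_eq_cube)
  \<comment> \<open>For a nonempty cover each of the four summands is at most
    \<open>card C ^ 3\<close>; for an empty one both sides vanish.\<close>
  also have "\<dots> \<le> 4 * card C ^ 3"
  proof (cases "card C")
    case (Suc k)
    have "card C ^ 1 \<le> card C ^ 3" "card C ^ 2 \<le> card C ^ 3"
      by (rule power_increasing; simp add: Suc)+
    then show ?thesis by simp
  qed simp
  finally show ?thesis unfolding C_def .
qed

section \<open>The kernelization\<close>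

definition tree_verts :: "btree \<Rightarrow> btree list" where
  "tree_verts d = unary_upto (left d)"

text \<open>The head after dropping \<open>v\<close> entries is the bit at position
  \<open>v\<close>; past the end it is \<open>Leaf\<close>, that is, false.\<close>

definition tree_cover :: "btree \<Rightarrow> btree \<Rightarrow> bool" where
  "tree_cover d v \<longleftrightarrow> left (tree_drop v (left d)) \<noteq> Leaf"

definition tree_adj :: "btree \<Rightarrow> btree \<Rightarrow> btree \<Rightarrow> bool" where
  "tree_adj d u v \<longleftrightarrow> left (tree_drop v (left (tree_drop u (right d)))) \<noteq> Leaf"

text \<open>Truncated subtraction: on numerals, the difference is not \<open>Leaf\<close> exactly if
  the second number is larger.\<close>

definition tree_less :: "btree \<Rightarrow> btree \<Rightarrow> bool" where
  "tree_less u v \<longleftrightarrow> tree_drop u v \<noteq> Leaf"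

definition tree_early :: "btree \<Rightarrow> bool" where
  "tree_early d \<longleftrightarrow> early_separable (set (tree_verts d)) (tree_cover d) (tree_adj d) tree_less"

definition tree_kept :: "btree \<Rightarrow> btree list" where
  "tree_kept d = filter (kept (set (tree_verts d)) (tree_cover d) (tree_adj d) tree_less) (tree_verts d)"

text \<open>The early answer is a fixed yes-instance. Otherwise, restricting vector and matrix to
  the kept vertices implicitly renames these to their positions in
  \<open>tree_kept d\<close>.\<close>

definition tree_kernel :: "btree \<Rightarrow> btree" where
  "tree_kernel d = (if tree_early d then encode \<lparr>pverts = {..<2}, parcs = {}\<rparr> {} else
     Node (encode_list (map (\<lambda>v. encode_bool (tree_cover d v)) (tree_kept d)))
       (encode_list (map (\<lambda>u. encode_list (map (\<lambda>v. encode_bool (tree_adj d u v)) (tree_kept d))) (tree_kept d))))"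

lemma ptime_tree_verts: "ptime a \<Longrightarrow> ptime (\<lambda>d. encode_list (tree_verts (a d)))"
  unfolding tree_verts_def by (intro ptime_unary_upto ptime_basic)

lemma ptime_tree_cover: "ptime a \<Longrightarrow> ptime b \<Longrightarrow> ptime (\<lambda>d. encode_bool (tree_cover (a d) (b d)))"
  unfolding tree_cover_def by (intro ptime_nonleaf ptime_tree_drop ptime_basic)

lemma ptime_tree_adj:
  "ptime a \<Longrightarrow> ptime b \<Longrightarrow> ptime c \<Longrightarrow> ptime (\<lambda>d. encode_bool (tree_adj (a d) (b d) (c d)))"
  unfolding tree_adj_def by (intro ptime_nonleaf ptime_tree_drop ptime_basic)

lemma ptime_tree_less: "ptime a \<Longrightarrow> ptime b \<Longrightarrow> ptime (\<lambda>d. encode_bool (tree_less (a d) (b d)))"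
  unfolding tree_less_def by (intro ptime_nonleaf ptime_tree_drop ptime_basic)

lemmas ptime_query = ptime_bex ptime_not ptime_conj ptime_disj
  ptime_tree_verts ptime_tree_cover ptime_tree_adj ptime_tree_less
  ptime_left ptime_right ptime_id

lemma ptime_tree_early: "ptime (\<lambda>d. encode_bool (tree_early d))"
  unfolding tree_early_def early_separable_def by (intro ptime_query)

lemma ptime_tree_kept: "ptime a \<Longrightarrow> ptime (\<lambda>d. encode_list (tree_kept (a d)))"
proof (rule ptime_comp[of "\<lambda>d. encode_list (tree_kept d)"])
  show "ptime (\<lambda>d. encode_list (tree_kept d))"
    \<comment> \<open>The formula is unfolded only once the filter rule has supplied the vertex it
      speaks about; then \<open>ptime_query\<close> covers its connectives.\<close>
    unfolding tree_kept_def
    by (intro ptime_filter ptime_tree_verts ptime_id, unfold kept_def is_first_def has_twin_def)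
      (intro ptime_query)
qed

lemma ptime_tree_kernel: "ptime tree_kernel"
  unfolding tree_kernel_def
  by (intro ptime_if ptime_tree_early ptime_map ptime_tree_kept ptime_tree_cover ptime_tree_adj ptime_basic)

section \<open>Induced subgraphs on renumbered vertices\<close>

definition induced_graph :: "nat pair_pre_digraph \<Rightarrow> nat list \<Rightarrow> nat pair_pre_digraph" where
  "induced_graph G ks = \<lparr>pverts = {..<length ks},
     parcs = {(i, j). i < length ks \<and> j < length ks \<and> (ks ! i, ks ! j) \<in> parcs G}\<rparr>"

definition induced_cover :: "nat set \<Rightarrow> nat list \<Rightarrow> nat set" where
  "induced_cover X ks = {i. i < length ks \<and> ks ! i \<in> X}"

text \<open>Instances have initial segments of the numbers as vertex sets, so vertices become
  positions in \<open>ks\<close>; this identifies the restricted vector and matrix as the code of an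
  instance.\<close>

lemma encode_induced:
  "encode (induced_graph G ks) (induced_cover X ks) =
     Node (encode_list (map (\<lambda>v. encode_bool (v \<in> X)) ks))
       (encode_list (map (\<lambda>u. encode_list (map (\<lambda>v. encode_bool ((u, v) \<in> parcs G)) ks)) ks))"
proof -
  have nth: "map f ks = map (\<lambda>i. f (ks ! i)) [0..<length ks]" for f :: "nat \<Rightarrow> btree"
    by (rule nth_equalityI) auto
  show ?thesis
    unfolding nth by (simp add: encode_def Let_def induced_graph_def induced_cover_def cong: map_cong)
qed

text \<open>Twins of \<open>G\<close> remain twins in an induced subgraph.\<close>

lemma tc_instance_induced:
  assumes inst: "tc_instance G X" and ks: "distinct ks"
  shows "tc_instance (induced_graph G ks) (induced_cover X ks)"
proof -
  interpret pair_graph G using inst by (simp add: tc_instance_def)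
  let ?H = "induced_graph G ks"
  have "pair_graph ?H"
  proof
    show "finite (parcs ?H)"
      by (rule finite_subset[of _ "{..<length ks} \<times> {..<length ks}"]) (auto simp: induced_graph_def)
    show "symmetric (with_proj ?H)"
      using sym_arcs by (auto simp: symmetric_def sym_def induced_graph_def)
  qed (auto simp: induced_graph_def dest: pair_no_loops)
  moreover have "twin_cover ?H (induced_cover X ks)"
    unfolding twin_cover_def
  proof (intro conjI ballI case_prodI2 impI)
    show "induced_cover X ks \<subseteq> pverts ?H"
      by (auto simp: induced_cover_def induced_graph_def)
    fix e i j assume "e \<in> parcs ?H" "e = (i, j)" "i \<notin> induced_cover X ks" "j \<notin> induced_cover X ks"
    then have ij: "i < length ks" "j < length ks" "(ks ! i, ks ! j) \<in> parcs G" "ks ! i \<notin> X" "ks ! j \<notin> X"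
      by (auto simp: induced_graph_def induced_cover_def)
    then have eq: "closed_nbhd G (ks ! i) = closed_nbhd G (ks ! j)"
      using inst by (auto simp: tc_instance_def twin_cover_def)
    \<comment> \<open>As \<open>ks\<close> is distinct, \<open>ks ! k = ks ! i\<close> means
      \<open>k = i\<close>, so the vertex itself is matched correctly too.\<close>
    have "closed_nbhd ?H i = {k. k < length ks \<and> ks ! k \<in> closed_nbhd G (ks ! i)}" if "i < length ks" for i
      using that ks by (auto simp: closed_nbhd_def induced_graph_def nth_eq_iff_index_eq)
    with ij eq show "closed_nbhd ?H i = closed_nbhd ?H j" by simp
  qed
  ultimately show ?thesis
    by (auto simp: tc_instance_def induced_graph_def)
qed

lemma separable_induced:
  assumes "distinct ks"
  shows "separable (pverts (induced_graph G ks)) (\<lambda>u v. (u, v) \<in> parcs (induced_graph G ks)) \<longleftrightarrow>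
    separable (set ks) (\<lambda>u v. (u, v) \<in> parcs G)"
  by (rule separable_bij[of "(!) ks"]) (auto simp: induced_graph_def intro: bij_betw_nth[OF assms])

lemma twin_covered_instance:
  assumes "tc_instance G X"
  shows "twin_covered (pverts G) (\<lambda>v. v \<in> X) (\<lambda>u v. (u, v) \<in> parcs G)"
proof -
  interpret pair_graph G using assms by (simp add: tc_instance_def)
  show ?thesis
  proof
    show "(v, u) \<in> parcs G" if "(u, v) \<in> parcs G" for u v
      using that by (rule arcs_symmetric)
    fix u v w assume uv: "u \<notin> X" "v \<notin> X" "(u, v) \<in> parcs G" and w: "w \<noteq> v" "(u, w) \<in> parcs G"
    have "closed_nbhd G u = closed_nbhd G v"
      using assms uv by (auto simp: tc_instance_def twin_cover_def)
    moreover have "w \<in> closed_nbhd G u"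
      using w by (simp add: closed_nbhd_def)
    ultimately show "(v, w) \<in> parcs G"
      using w(1) by (auto simp: closed_nbhd_def)
  qed
qed

section \<open>Correctness on encoded instances\<close>

locale encoded_instance =
  fixes G :: "nat pair_pre_digraph" and X :: "nat set" and n :: nat
  assumes inst: "tc_instance G X" and pverts_eq: "pverts G = {..<n}"
begin

sublocale pair_graph G
  using inst by (simp add: tc_instance_def)

lemma cover_subset: "X \<subseteq> {..<n}"
  using inst by (simp add: tc_instance_def twin_cover_def pverts_eq)

lemma encode_eq: "encode G X =
  Node (encode_list (map (\<lambda>v. encode_bool (v \<in> X)) [0..<n]))
    (encode_list (map (\<lambda>u. encode_list (map (\<lambda>v. encode_bool ((u, v) \<in> parcs G)) [0..<n])) [0..<n]))"
  by (simp add: encode_def Let_def pverts_eq)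

lemma tree_verts_encode: "tree_verts (encode G X) = map unary (rev [0..<n])"
  by (simp add: tree_verts_def encode_eq unary_upto_def)

lemma set_tree_verts_encode: "set (tree_verts (encode G X)) = unary ` pverts G"
  by (simp add: tree_verts_encode pverts_eq atLeast0LessThan)

lemma left_drop_map_upt:
  "left (encode_list (drop v (map f [0..<n]))) = (if v < n then f v else Leaf)"
  by (simp add: drop_map left_encode_list upt_conv_Cons)

text \<open>No range condition on \<open>v\<close> arises: positions past the end read
  \<open>Leaf\<close>, and \<open>X\<close> has no such elements.\<close>

lemma tree_cover_encode: "tree_cover (encode G X) (unary v) \<longleftrightarrow> v \<in> X"
  using cover_subset by (cases "v \<in> X") (auto simp: tree_cover_def encode_eq left_drop_map_upt)

lemma tree_adj_encode: "tree_adj (encode G X) (unary u) (unary v) \<longleftrightarrow> (u, v) \<in> parcs G"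
proof -
  \<comment> \<open>A row out of range reads as \<open>Leaf\<close>; its entries must then read as
    \<open>Leaf\<close> too.\<close>
  have "tree_drop (unary v) Leaf = Leaf"
    using tree_drop_unary[of v "[]"] by simp
  moreover have "(u, v) \<in> parcs G \<Longrightarrow> u < n \<and> v < n"
    using wellformed'[of u v] by (simp add: pverts_eq)
  ultimately show ?thesis
    by (cases "(u, v) \<in> parcs G") (auto simp: tree_adj_def encode_eq left_drop_map_upt)
qed

lemma tree_less_unary: "tree_less (unary u) (unary v) \<longleftrightarrow> u < v"
  by (auto simp: tree_less_def)

lemmas tree_encode = set_tree_verts_encode tree_cover_encode tree_adj_encode tree_less_unary

lemma tree_early_encode:
  "tree_early (encode G X) \<longleftrightarrow> early_separable (pverts G) (\<lambda>v. v \<in> X) (\<lambda>u v. (u, v) \<in> parcs G) (<)"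
  unfolding tree_early_def early_separable_def by (simp add: tree_encode)

definition kept_verts :: "nat list" where
  "kept_verts = filter (kept (pverts G) (\<lambda>v. v \<in> X) (\<lambda>u v. (u, v) \<in> parcs G) (<)) (rev [0..<n])"

lemma tree_kept_encode: "tree_kept (encode G X) = map unary kept_verts"
proof -
  have "kept (unary ` pverts G) (tree_cover (encode G X)) (tree_adj (encode G X)) tree_less (unary v) \<longleftrightarrow>
      kept (pverts G) (\<lambda>v. v \<in> X) (\<lambda>u v. (u, v) \<in> parcs G) (<) v" for v
    by (simp add: kept_def is_first_def has_twin_def tree_encode)
  then show ?thesis
    unfolding tree_kept_def set_tree_verts_encode
    by (simp add: tree_verts_encode kept_verts_def filter_map comp_def)
qed

lemma distinct_kept_verts: "distinct kept_verts"
  by (simp add: kept_verts_def)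

lemma set_kept_verts:
  "set kept_verts = {v \<in> pverts G. kept (pverts G) (\<lambda>v. v \<in> X) (\<lambda>u v. (u, v) \<in> parcs G) (<) v}"
  by (auto simp: kept_verts_def pverts_eq)

text \<open>The bound 2 belongs to the fixed yes-instance, the cubic bound to the instance induced
  by the kept vertices.\<close>

lemma tree_kernel_encode:
  "\<exists>G' X'. tree_kernel (encode G X) = encode G' X' \<and> tc_instance G' X' \<and>
     ((\<exists>S. stable_cutset G' S) \<longleftrightarrow> (\<exists>S. stable_cutset G S)) \<and>
     (card (pverts G') \<le> 4 * card X ^ 3 \<or> card (pverts G') \<le> 2)"
proof -
  interpret twin_covered "pverts G" "\<lambda>v. v \<in> X" "\<lambda>u v. (u, v) \<in> parcs G"
    using inst by (rule twin_covered_instance)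
  show ?thesis
  proof (cases "tree_early (encode G X)")
    case True
    let ?G = "\<lparr>pverts = {..<2}, parcs = {}\<rparr> :: nat pair_pre_digraph"
    have "pair_graph ?G"
      by unfold_locales (auto simp: symmetric_def sym_def)
    then have yes: "tc_instance ?G {}"
      by (auto simp: tc_instance_def twin_cover_def)
    \<comment> \<open>Nothing is removed: the two isolated vertices are the sides.\<close>
    have "separation (pverts ?G) (\<lambda>u v. (u, v) \<in> parcs ?G) {0} {1}"
      by (auto simp: separation_def)
    then have "\<exists>S. stable_cutset ?G S"
      using yes by (subst ex_stable_cutset_iff) (auto simp: tc_instance_def separable_def)
    moreover have "\<exists>S. stable_cutset G S"
      using early_separableD True by (simp add: ex_stable_cutset_iff pair_graph tree_early_encode)
    moreover have "tree_kernel (encode G X) = encode ?G {}"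
      using True by (simp add: tree_kernel_def)
    ultimately show ?thesis
      using yes by (intro exI[of _ ?G] exI[of _ "{}"]) auto
  next
    case False
    let ?G = "induced_graph G kept_verts" and ?X = "induced_cover X kept_verts"
    have enc: "tree_kernel (encode G X) = encode ?G ?X"
      using False by (simp add: tree_kernel_def tree_kept_encode encode_induced tree_encode comp_def)
    have inst': "tc_instance ?G ?X"
      by (rule tc_instance_induced[OF inst distinct_kept_verts])
    then have "(\<exists>S. stable_cutset ?G S) \<longleftrightarrow> (\<exists>S. stable_cutset G S)"
      using False separable_kept
      by (simp add: ex_stable_cutset_iff tc_instance_def pair_graph separable_induced distinct_kept_verts
          set_kept_verts tree_early_encode)
    moreover have "card (pverts ?G) \<le> 4 * card X ^ 3"
    proof -
      have "card (pverts ?G) = card (set kept_verts)"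
        by (simp add: induced_graph_def distinct_card[OF distinct_kept_verts])
      also have "\<dots> \<le> 4 * card {x \<in> pverts G. x \<in> X} ^ 3"
        unfolding set_kept_verts by (rule card_kept_le) simp
      also have "{x \<in> pverts G. x \<in> X} = X"
        using inst by (auto simp: tc_instance_def twin_cover_def)
      finally show ?thesis .
    qed
    ultimately show ?thesis
      using enc inst' by blast
  qed
qed

end

theorem theorem4:
  shows "\<exists>(kernel :: com) (p :: nat poly) (c :: nat) (d :: nat).
    \<forall>G X. tc_instance G X \<longrightarrow>
      (\<exists>t G' X'.
         computes_in_time kernel (encode G X) t (encode G' X') \<and>
         t \<le> poly p (size (encode G X)) \<and>
         tc_instance G' X' \<and>
         ((\<exists>S. stable_cutset G' S) \<longleftrightarrow> (\<exists>S. stable_cutset G S)) \<and>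
         (card (pverts G') \<le> c * card X ^ 3 \<or> card (pverts G') \<le> d))"
proof -
  obtain kernel m p where kernel: "runs kernel m p tree_kernel"
    using ptime_tree_kernel unfolding ptime_def by blast
  have "\<exists>t G' X'. computes_in_time kernel (encode G X) t (encode G' X') \<and>
      t \<le> poly p (size (encode G X)) \<and> tc_instance G' X' \<and>
      ((\<exists>S. stable_cutset G' S) \<longleftrightarrow> (\<exists>S. stable_cutset G S)) \<and>
      (card (pverts G') \<le> 4 * card X ^ 3 \<or> card (pverts G') \<le> 2)"
    if inst: "tc_instance G X" for G X
  proof -
    obtain n where "pverts G = {..<n}"
      using inst by (auto simp: tc_instance_def)
    with inst interpret encoded_instance G X n
      by unfold_locales
    have "input_state (encode G X) 0 = encode G X"
      by (simp add: input_state_def)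
    \<comment> \<open>\<open>runs\<close> covers every initial state, in particular
      \<open>input_state\<close>, where variable 0 holds the encoding.\<close>
    then obtain t where "computes_in_time kernel (encode G X) t (tree_kernel (encode G X))"
      "t \<le> poly p (size (encode G X))"
      using runsE[OF kernel, where s = "input_state (encode G X)"]
      unfolding exec_within_def computes_in_time_def by metis
    then show ?thesis
      using tree_kernel_encode by metis
  qed
  \<comment> \<open>The constants are \<open>c = 4\<close> from \<open>card_kept_le\<close> and
    \<open>d = 2\<close> from the fixed yes-instance.\<close>
  then show ?thesis by blast
qed

end
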